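(* Let $X$ denote a strictly convex $C^{(3)}$ curve in the plane $\mathbb{R}^2$. Then the following are equivalent. 1) For all $P\in X$ and sufficiently small $h>0$, $U_P(h)=\lambda(P)T_P(h)$, where $\lambda(P)$ is a function of $P$. 2) For all $P\in X$ and sufficiently small $h>0$, $U_P(h)=\frac{1}{2}T_P(h)$. 3) $X$ is an open part of a parabola.
   Context: All curves are of class $C^{(3)}$ and connected. A regular plane curve $X:I\to\mathbb{R}^2$ on an open interval $I$ is convex if for all $t\in I$ the trace $X(I)$ lies entirely in one of the closed half-planes determined by the tangent line at $X(t)$. A simple convex curve $X$ in $\mathbb{R}^2$ is called strictly convex if it is of class $C^{(3)}$ and has positive curvature $\kappa$ with respect to the unit normal $N$ pointing to the convex side, i.e. $\kappa(s)=\langle X''(s),N(X(s))\rangle>0$ for an arclength parametrization $X(s)$. For $P=A\in X$ and sufficiently small $h>0$, let $\ell$ be the tangent line of $X$ at $P$, let $m$ be the line through $P+hN(P)$ parallel to $\ell$, and let $A_1,A_2$ be the points where $m$ intersects $X$. Let $\ell_1,\ell_2$ be the tangent lines of $X$ at $A_1,A_2$, and let $B=\ell_1\cap\ell_2$, $B_1=\ell\cap\ell_1$, $B_2=\ell\cap\ell_2$. $T_P(h)$ is the area of the triangle $AA_1A_2$ and $U_P(h)$ is the area of the triangle $BB_1B_2$. "For all $P\in X$ and sufficiently small $h>0$" means: for every $P\in X$ there is $h_0(P)>0$ such that the property holds for all $0<h<h_0(P)$. An open part of a parabola is a connected (relatively) open arc of a parabola, of arbitrary position in the plane. *)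

theory Defs
  imports "HOL-Analysis.Analysis"
begin

section \<open>Lines, triangles, parabolas\<close>

definition line_dir :: "real^2 \<Rightarrow> real^2 \<Rightarrow> (real^2) set" where
  "line_dir a v = {a + c *\<^sub>R v | c. True}"

definition triangle_area :: "real^2 \<Rightarrow> real^2 \<Rightarrow> real^2 \<Rightarrow> real" where
  "triangle_area a b c = measure lebesgue (convex hull {a, b, c})"

definition meet :: "(real^2) set \<Rightarrow> (real^2) set \<Rightarrow> real^2" where
  "meet l l' = (THE p. l \<inter> l' = {p})"

text \<open>Focus \<open>F\<close> and directrix \<open>line_dir a v\<close>.\<close>

definition parabola :: "(real^2) set \<Rightarrow> bool" where
  "parabola S \<longleftrightarrow> (\<exists>F a v. v \<noteq> 0 \<and> F \<notin> line_dir a v \<and>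
     S = {p. dist p F = infdist p (line_dir a v)})"

definition open_part_of_parabola :: "(real^2) set \<Rightarrow> bool" where
  "open_part_of_parabola C \<longleftrightarrow>
     (\<exists>S. parabola S \<and> openin (top_of_set S) C \<and> connected C \<and> C \<noteq> {})"

section \<open>Strictly convex curves\<close>

primrec class_C_on :: "nat \<Rightarrow> (real \<Rightarrow> 'a::real_normed_vector) \<Rightarrow> real set \<Rightarrow> bool" where
  "class_C_on 0 X I \<longleftrightarrow> continuous_on I X"
| "class_C_on (Suc k) X I \<longleftrightarrow>
     (\<forall>t\<in>I. X differentiable at t) \<and> class_C_on k (\<lambda>t. vector_derivative X (at t)) I"

abbreviation velocity :: "(real \<Rightarrow> real^2) \<Rightarrow> real \<Rightarrow> real^2" where
  "velocity X t \<equiv> vector_derivative X (at t)"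

definition regular_C3_curve :: "(real \<Rightarrow> real^2) \<Rightarrow> real set \<Rightarrow> bool" where
  "regular_C3_curve X I \<longleftrightarrow>
     open I \<and> is_interval I \<and> I \<noteq> {} \<and> class_C_on 3 X I \<and> (\<forall>t\<in>I. velocity X t \<noteq> 0)"

definition tangent_line :: "(real \<Rightarrow> real^2) \<Rightarrow> real \<Rightarrow> (real^2) set" where
  "tangent_line X t = line_dir (X t) (velocity X t)"

text \<open>A unit normal \<open>n\<close> of the tangent line at \<open>X t\<close> such that the trace lies in the closed
  half-plane of that line into which \<open>n\<close> points. Since \<open>n\<close> may be either of the two unit
  normals, existence of such an \<open>n\<close> means that the trace lies in one of the two closed
  half-planes.\<close>

definition supporting_normal :: "(real \<Rightarrow> real^2) \<Rightarrow> real set \<Rightarrow> real \<Rightarrow> real^2 \<Rightarrow> bool" where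
  "supporting_normal X I t n \<longleftrightarrow>
     norm n = 1 \<and> n \<bullet> velocity X t = 0 \<and> (\<forall>s\<in>I. 0 \<le> n \<bullet> (X s - X t))"

definition convex_curve :: "(real \<Rightarrow> real^2) \<Rightarrow> real set \<Rightarrow> bool" where
  "convex_curve X I \<longleftrightarrow> regular_C3_curve X I \<and> (\<forall>t\<in>I. \<exists>n. supporting_normal X I t n)"

text \<open>For a convex curve this is well defined unless the trace is contained in a line.\<close>

definition convex_side_normal :: "(real \<Rightarrow> real^2) \<Rightarrow> real set \<Rightarrow> real \<Rightarrow> real^2" where
  "convex_side_normal X I t = (THE n. supporting_normal X I t n)"

text \<open>\<open>Y\<close> on \<open>J\<close> is the reparametrization of \<open>X\<close> on \<open>I\<close> by an arclength function \<open>\<sigma>\<close>, that is,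
  an antiderivative of the speed.\<close>

definition arclength_parametrization ::
  "(real \<Rightarrow> real^2) \<Rightarrow> real set \<Rightarrow> (real \<Rightarrow> real^2) \<Rightarrow> real set \<Rightarrow> bool" where
  "arclength_parametrization X I Y J \<longleftrightarrow>
     (\<exists>\<sigma>. (\<forall>t\<in>I. (\<sigma> has_real_derivative norm (velocity X t)) (at t)) \<and>
          \<sigma> ` I = J \<and> (\<forall>t\<in>I. X t = Y (\<sigma> t)))"

definition arclength_curvature :: "(real \<Rightarrow> real^2) \<Rightarrow> real set \<Rightarrow> real \<Rightarrow> real" where
  "arclength_curvature Y J s = velocity (velocity Y) s \<bullet> convex_side_normal Y J s"

definition strictly_convex_curve :: "(real \<Rightarrow> real^2) \<Rightarrow> real set \<Rightarrow> bool" where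
  "strictly_convex_curve X I \<longleftrightarrow> convex_curve X I \<and> inj_on X I \<and>
     (\<exists>Y J. arclength_parametrization X I Y J \<and> (\<forall>s\<in>J. arclength_curvature Y J s > 0))"

section \<open>The areas \<open>T\<close> and \<open>U\<close> at the point \<open>X t\<close>\<close>

definition chord_line :: "(real \<Rightarrow> real^2) \<Rightarrow> real set \<Rightarrow> real \<Rightarrow> real \<Rightarrow> (real^2) set" where
  "chord_line X I t h = line_dir (X t + h *\<^sub>R convex_side_normal X I t) (velocity X t)"

text \<open>The parameters of the two points \<open>A\<^sub>1\<close>, \<open>A\<^sub>2\<close> of the curve on the chord line, labelled in
  increasing order; both areas below are symmetric in the two points. For a strictly convex
  curve and small \<open>h > 0\<close> there are exactly two such points.\<close>

definition chord_params :: "(real \<Rightarrow> real^2) \<Rightarrow> real set \<Rightarrow> real \<Rightarrow> real \<Rightarrow> real \<times> real" where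
  "chord_params X I t h =
     (THE (s1, s2). s1 < s2 \<and> {s \<in> I. X s \<in> chord_line X I t h} = {s1, s2})"

definition T_area :: "(real \<Rightarrow> real^2) \<Rightarrow> real set \<Rightarrow> real \<Rightarrow> real \<Rightarrow> real" where
  "T_area X I t h =
     (let (s1, s2) = chord_params X I t h in triangle_area (X t) (X s1) (X s2))"

definition U_area :: "(real \<Rightarrow> real^2) \<Rightarrow> real set \<Rightarrow> real \<Rightarrow> real \<Rightarrow> real" where
  "U_area X I t h =
     (let (s1, s2) = chord_params X I t h;
          l = tangent_line X t; l1 = tangent_line X s1; l2 = tangent_line X s2
      in triangle_area (meet l1 l2) (meet l l1) (meet l l2))"

end

theory Submission
  imports Defs
begin

text \<open>Fix a point \<open>P = X t\<close> of the curve, with velocity \<open>v\<close> and a normal vector \<open>n\<close>, and write a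
  point as \<open>P + \<xi> v + c n\<close>. For small \<open>c > 0\<close> the line at height \<open>c\<close> meets the curve in exactly
  two points (\<open>ex_chord\<close>); let \<open>L\<close> be the difference of their \<open>\<xi>\<close>-coordinates. Elementary
  geometry (\<open>chord_triangle_areas\<close>) gives, up to a common factor, \<open>T = c L\<close> and
  \<open>U = (L - c L')\<^sup>2 / L'\<close>, where \<open>L'\<close> is the derivative of \<open>L\<close> with respect to \<open>c\<close>. With
  \<open>r = c L' / L\<close> the equation \<open>U = \<lambda> T\<close> becomes \<open>(1 - r)\<^sup>2 = \<lambda> r\<close>. Positive curvature makes
  \<open>L\<close> asymptotic to a multiple of the square root of \<open>c\<close>, so \<open>r\<close> tends to \<open>1/2\<close>
  (\<open>chord_limits\<close>). Hence \<open>\<lambda> = 1/2\<close>, and since the roots of \<open>(1 - r)\<^sup>2 = r / 2\<close> are \<open>1/2\<close> and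
  \<open>2\<close>, the condition says \<open>r = 1/2\<close> for small \<open>c\<close>. This is a differential equation with
  solution \<open>L\<^sup>2 = 8 c / D\<close>, where the constant is read off from the curvature term \<open>D\<close>
  (\<open>width_of_half_ratio\<close>).

  It remains to see that a curve all of whose small chords satisfy \<open>L\<^sup>2 = 8 c / D\<close> is an arc of
  a parabola. The size of the allowed \<open>c\<close> depends on the point without any uniformity, so the
  chord equation cannot be differentiated along the curve; a maximum principle takes the place
  of differentiation. Locally the curve is a graph \<open>y = f(x)\<close>. Put \<open>g = f''\<close> to the power
  \<open>-2/3\<close>. If \<open>g\<close> is not an affine function of \<open>x\<close>, then as in Schwarz's theorem on second
  symmetric derivatives some quadratic polynomial \<open>q\<close>, not affine, touches \<open>g\<close> from one side
  at an interior point (\<open>affine_if_never_touched\<close>). The solution \<open>F\<close> of \<open>F''\<close> \<open>=\<close> \<open>q\<close> to the power \<open>-3/2\<close>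
  is an arc of an ellipse or a hyperbola that lies on one side of the curve near the point of
  contact (\<open>comparison_with_conic\<close>), while its chords are strictly shorter, respectively
  longer, than those of the curve (\<open>conic_chord_too_short_or_long\<close>), which is
  impossible (\<open>not_touched_by_conic\<close>). So \<open>g\<close> is affine in every frame, which says that the
  affine normal of the curve is constant (\<open>affine_normal_constant\<close>). In the parameter of affine arclength the curve is
  then a quadratic polynomial, that is, an arc of a parabola.

  Conversely, on a parabola \<open>r = 1/2\<close> is a direct computation (\<open>ratio_on_parabola\<close>).\<close>

section \<open>Plane vectors, lines and triangles\<close>

text \<open>The determinant of two plane vectors.\<close>

definition cross2 :: "real^2 \<Rightarrow> real^2 \<Rightarrow> real" where
  "cross2 a b = a $ 1 * b $ 2 - a $ 2 * b $ 1"

text \<open>Rotation by a quarter turn, counterclockwise.\<close>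

definition rot :: "real^2 \<Rightarrow> real^2" where
  "rot v = vector [- v $ 2, v $ 1]"

lemma inner_real2: "(a::real^2) \<bullet> b = a $ 1 * b $ 1 + a $ 2 * b $ 2"
  by (simp add: inner_vec_def sum_2)

lemma vec2_eq_iff: "(a::real^2) = b \<longleftrightarrow> a $ 1 = b $ 1 \<and> a $ 2 = b $ 2"
  by (simp add: vec_eq_iff forall_2)

lemma rot_component [simp]: "rot v $ 1 = - v $ 2" "rot v $ 2 = v $ 1"
  by (simp_all add: rot_def)

lemmas plane_simps = inner_real2 vec2_eq_iff cross2_def

lemma bounded_bilinear_cross2: "bounded_bilinear cross2"
proof -
  have "bounded_bilinear (\<lambda>a b. cross2 a b)"
  proof
    show "\<exists>K. \<forall>a b. norm (cross2 a b) \<le> norm a * norm b * K"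
    proof (intro exI allI)
      fix a b :: "real^2"
      have "norm (cross2 a b) \<le> \<bar>a $ 1\<bar> * \<bar>b $ 2\<bar> + \<bar>a $ 2\<bar> * \<bar>b $ 1\<bar>"
        unfolding cross2_def by (simp add: abs_mult[symmetric])
      also have "\<dots> \<le> norm a * norm b + norm a * norm b"
        by (intro add_mono mult_mono) (auto simp: component_le_norm_cart)
      finally show "norm (cross2 a b) \<le> norm a * norm b * 2" by simp
    qed
  qed (auto simp: cross2_def algebra_simps)
  then show ?thesis by simp
qed

lemmas cross2_derivative [derivative_intros] =
  bounded_bilinear.has_vector_derivative[OF bounded_bilinear_cross2]
lemmas cross2_continuous_on [continuous_intros] =
  bounded_bilinear.continuous_on[OF bounded_bilinear_cross2]

lemma cross2_inner_has_real_derivative: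
  assumes "(f has_vector_derivative f') (at t)"
  shows "((\<lambda>s. cross2 a (f s)) has_real_derivative cross2 a f') (at t)"
    and "((\<lambda>s. a \<bullet> f s) has_real_derivative a \<bullet> f') (at t)"
  using bounded_linear.has_vector_derivative[OF bounded_bilinear.bounded_linear_right[OF bounded_bilinear_cross2] assms]
    bounded_linear.has_vector_derivative[OF bounded_linear_inner_right assms]
  by (auto simp: has_real_derivative_iff_has_vector_derivative)

lemma cross2_simps [simp]:
  "cross2 a a = 0" "cross2 0 b = 0" "cross2 a 0 = 0"
  "cross2 (c *\<^sub>R a) b = c * cross2 a b" "cross2 a (c *\<^sub>R b) = c * cross2 a b"
  by (simp_all add: cross2_def algebra_simps)

lemma cross2_add:
  "cross2 a (b + c) = cross2 a b + cross2 a c" "cross2 (a + b) c = cross2 a c + cross2 b c"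
  "cross2 a (b - c) = cross2 a b - cross2 a c" "cross2 (a - b) c = cross2 a c - cross2 b c"
  by (simp_all add: cross2_def algebra_simps)

lemma cross2_skew: "cross2 b a = - cross2 a b"
  by (simp add: cross2_def)

lemma rot_inner: "rot v \<bullet> z = cross2 v z"
  by (simp add: plane_simps)

lemma cross2_rot: "cross2 v (rot v) = v \<bullet> v"
  by (simp add: plane_simps)

lemma rot_norm: "norm (rot v) = norm v"
  by (simp add: norm_eq_sqrt_inner plane_simps)

lemma lagrange_cross2: "(a \<bullet> b)\<^sup>2 + (cross2 a b)\<^sup>2 = (a \<bullet> a) * (b \<bullet> b)"
  unfolding plane_simps by algebra

lemma abs_cross2_le: "\<bar>cross2 a b\<bar> \<le> norm a * norm b"
proof -
  have "(cross2 a b)\<^sup>2 \<le> (norm a * norm b)\<^sup>2"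
    using lagrange_cross2[of a b] by (simp add: power_mult_distrib power2_norm_eq_inner) (smt (verit) zero_le_power2)
  then show ?thesis by (metis abs_le_square_iff abs_mult abs_norm_cancel)
qed

lemma cross2_eq_0D:
  assumes "cross2 a b = 0" "a \<noteq> 0"
  shows "b = ((a \<bullet> b) / (a \<bullet> a)) *\<^sub>R a"
proof -
  have p: "a \<bullet> a > 0" using assms by simp
  have "(a \<bullet> a) *\<^sub>R b = (a \<bullet> b) *\<^sub>R a"
    using assms(1) unfolding plane_simps by simp algebra
  then have "(1 / (a \<bullet> a)) *\<^sub>R ((a \<bullet> a) *\<^sub>R b) = (1 / (a \<bullet> a)) *\<^sub>R ((a \<bullet> b) *\<^sub>R a)" by simp
  then show ?thesis using p by simp
qed

lemma cross2_expand: 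
  "(v \<bullet> v) *\<^sub>R z = (v \<bullet> z) *\<^sub>R v + cross2 v z *\<^sub>R rot v"
  unfolding plane_simps by (simp; algebra)

lemma frame_expand: 
  assumes "v \<noteq> 0"
  shows "z = ((v \<bullet> z) / (v \<bullet> v)) *\<^sub>R v + (cross2 v z / (v \<bullet> v)) *\<^sub>R rot v"
proof -
  have p: "v \<bullet> v \<noteq> 0" using assms by simp
  have "z = (1 / (v \<bullet> v)) *\<^sub>R ((v \<bullet> v) *\<^sub>R z)" using p by simp
  also have "\<dots> = ((v \<bullet> z) / (v \<bullet> v)) *\<^sub>R v + (cross2 v z / (v \<bullet> v)) *\<^sub>R rot v"
    unfolding cross2_expand by (simp add: scaleR_add_right)
  finally show ?thesis .
qed

lemma triangle_area_cross2: "triangle_area a b c = \<bar>cross2 (b - a) (c - a)\<bar> / 2"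
proof -
  have "compact (convex hull {a, b, c})" by (simp add: finite_imp_compact_convex_hull)
  then have "triangle_area a b c = measure lborel (convex hull {a, b, c})"
    unfolding triangle_area_def by (simp add: measure_completion borel_compact)
  then show ?thesis unfolding content_triangle by (simp add: cross2_def algebra_simps)
qed

lemma in_line_dir: "p \<in> line_dir a v \<longleftrightarrow> (\<exists>c. p = a + c *\<^sub>R v)"
  by (auto simp: line_dir_def)

lemma in_line_dir_iff_cross2:
  assumes "v \<noteq> 0"
  shows "p \<in> line_dir a v \<longleftrightarrow> cross2 v (p - a) = 0"
proof
  assume "cross2 v (p - a) = 0"
  from cross2_eq_0D[OF this assms] show "p \<in> line_dir a v"
    by (metis in_line_dir add.commute diff_add_cancel)
qed (auto simp: in_line_dir)

lemma meet_eqI: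
  assumes "p \<in> line_dir a v" "p \<in> line_dir b w" "cross2 v w \<noteq> 0"
  shows "meet (line_dir a v) (line_dir b w) = p"
proof -
  have v: "v \<noteq> 0" and w: "w \<noteq> 0" using assms(3) by auto
  have "q = p" if q: "q \<in> line_dir a v" "q \<in> line_dir b w" for q
  proof -
    have "cross2 v (q - p) = 0" "cross2 w (q - p) = 0"
      using q assms(1,2) unfolding in_line_dir_iff_cross2[OF v] in_line_dir_iff_cross2[OF w]
      by (simp_all add: cross2_add)
    then have "cross2 v w *\<^sub>R (q - p) = 0"
      unfolding plane_simps by (simp; algebra)
    then show ?thesis using assms(3) by simp
  qed
  then have "line_dir a v \<inter> line_dir b w = {p}" using assms by blast
  then show ?thesis unfolding meet_def by auto
qed

lemma infdist_line_dir:
  assumes "norm v = 1"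
  shows "infdist p (line_dir a v) = \<bar>cross2 v (p - a)\<bar>"
proof (rule antisym)
  have v: "v \<bullet> v = 1" "v \<noteq> 0" using assms by (auto simp: norm_eq_1)
  let ?q = "a + (v \<bullet> (p - a)) *\<^sub>R v"
  have "p - ?q = cross2 v (p - a) *\<^sub>R rot v"
    using frame_expand[OF v(2), of "p - a"] v by (simp add: algebra_simps)
  moreover have "norm (rot v) = 1" using v by (simp add: norm_eq_1 plane_simps)
  ultimately have "dist p ?q = \<bar>cross2 v (p - a)\<bar>" by (simp add: dist_norm)
  then show "infdist p (line_dir a v) \<le> \<bar>cross2 v (p - a)\<bar>"
    using infdist_le[of ?q "line_dir a v" p] by (auto simp: in_line_dir)
  have ne: "line_dir a v \<noteq> {}" by (auto simp: line_dir_def)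
  show "\<bar>cross2 v (p - a)\<bar> \<le> infdist p (line_dir a v)"
    unfolding infdist_notempty[OF ne]
  proof (rule cINF_greatest[OF ne])
    fix q assume "q \<in> line_dir a v"
    then have "cross2 v (p - a) = cross2 v (p - q)" by (auto simp: in_line_dir cross2_add)
    then show "\<bar>cross2 v (p - a)\<bar> \<le> dist p q"
      using abs_cross2_le[of v "p - q"] assms by (simp add: dist_norm)
  qed
qed

lemma line_dir_scale:
  assumes "c \<noteq> 0" shows "line_dir a (c *\<^sub>R v) = line_dir a v"
proof -
  have "\<exists>d. a + k *\<^sub>R v = a + d *\<^sub>R c *\<^sub>R v" for k
    using assms by (intro exI[of _ "k / c"]) simp
  then show ?thesis by (auto simp: line_dir_def)
qed

text \<open>The inner and the outer triangle in an affine frame \<open>(v, n)\<close> at \<open>P\<close>. The tangent directions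
  \<open>V1\<close>, \<open>V2\<close> at the endpoints of the chord enter only through their inverse slopes \<open>a1 / b1\<close> and
  \<open>a2 / b2\<close>. The vertex opposite to \<open>P + \<real> v\<close> lies at height \<open>h - L / M\<close>, and the side on that
  line has length \<open>L - h * M\<close> in units of \<open>v\<close>.\<close>

lemma chord_triangle_areas:
  fixes P v n :: "real^2"
  assumes fr: "cross2 v n \<noteq> 0" and h: "h > 0"
    and A: "A1 = P + h *\<^sub>R n + x1 *\<^sub>R v" "A2 = P + h *\<^sub>R n + x2 *\<^sub>R v"
    and V: "V1 = a1 *\<^sub>R v + b1 *\<^sub>R n" "V2 = a2 *\<^sub>R v + b2 *\<^sub>R n"
    and b: "b1 \<noteq> 0" "b2 \<noteq> 0" and L: "L = x2 - x1" "L > 0" and M: "M = a2 / b2 - a1 / b1" "M > 0"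
  shows "triangle_area P A1 A2 = \<bar>cross2 v n\<bar> / 2 * (h * L)"
    and "triangle_area (meet (line_dir A1 V1) (line_dir A2 V2))
           (meet (line_dir P v) (line_dir A1 V1)) (meet (line_dir P v) (line_dir A2 V2))
         = \<bar>cross2 v n\<bar> / 2 * ((L - h * M)\<^sup>2 / M)"
proof -
  have "cross2 (A1 - P) (A2 - P) = h * x2 * cross2 n v + x1 * h * cross2 v n"
    unfolding A by (simp add: cross2_add algebra_simps)
  also have "\<dots> = - (h * L * cross2 v n)"
    unfolding L using cross2_skew[of n v] by (simp add: algebra_simps)
  finally show "triangle_area P A1 A2 = \<bar>cross2 v n\<bar> / 2 * (h * L)"
    using h L by (simp add: triangle_area_cross2 abs_mult)
next
  have n: "cross2 v V1 = b1 * cross2 v n" "cross2 v V2 = b2 * cross2 v n"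
    unfolding V by (simp_all add: cross2_add)
  have n12: "cross2 V1 V2 = (a1 * b2 - a2 * b1) * cross2 v n"
    unfolding V using cross2_skew[of n v] by (simp add: cross2_add algebra_simps)
  have ne: "a1 * b2 - a2 * b1 \<noteq> 0" using M b by (auto simp: field_simps)
  define r1 r2 where "r1 = a1 / b1" and "r2 = a2 / b2"
  define k where "k = - (L / M)"
  have aa: "a1 = r1 * b1" "a2 = r2 * b2" unfolding r1_def r2_def using b by auto
  have M': "M = r2 - r1" using M r1_def r2_def by simp
  have on: "P + (x1 - h * r1) *\<^sub>R v = A1 + (- h / b1) *\<^sub>R V1"
    "P + (x2 - h * r2) *\<^sub>R v = A2 + (- h / b2) *\<^sub>R V2"
    unfolding A V aa using b by (simp_all add: algebra_simps)
  have B1: "meet (line_dir P v) (line_dir A1 V1) = P + (x1 - h * r1) *\<^sub>R v"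
    by (rule meet_eqI) (use on(1) fr b n in \<open>unfold in_line_dir, blast, blast, simp\<close>)
  have B2: "meet (line_dir P v) (line_dir A2 V2) = P + (x2 - h * r2) *\<^sub>R v"
    by (rule meet_eqI) (use on(2) fr b n in \<open>unfold in_line_dir, blast, blast, simp\<close>)
  define p where "p = P + (h + k) *\<^sub>R n + (x1 + r1 * k) *\<^sub>R v"
  have kM: "x1 + r1 * k = x2 + r2 * k"
    using M(2) unfolding k_def L(1) M' by (simp add: field_simps)
  have "p = A1 + (k / b1) *\<^sub>R V1" unfolding p_def A V aa using b by (simp add: algebra_simps)
  moreover have "p = A2 + (k / b2) *\<^sub>R V2"
    unfolding p_def kM A V aa using b by (simp add: algebra_simps)
  ultimately have B: "meet (line_dir A1 V1) (line_dir A2 V2) = p"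
    by (intro meet_eqI) (use n12 ne fr in \<open>unfold in_line_dir, blast, blast, simp\<close>)
  have "cross2 (P + (x1 - h * r1) *\<^sub>R v - p) (P + (x2 - h * r2) *\<^sub>R v - p)
     = (h + k) * (x2 - h * r2 - (x1 - h * r1)) * cross2 v n"
    unfolding p_def by (simp add: cross2_def algebra_simps)
  also have "x2 - h * r2 - (x1 - h * r1) = L - h * M" unfolding L M' by (simp add: algebra_simps)
  also have "h + k = - ((L - h * M) / M)" unfolding k_def using M(2) by (simp add: field_simps)
  finally have "\<bar>cross2 (P + (x1 - h * r1) *\<^sub>R v - p) (P + (x2 - h * r2) *\<^sub>R v - p)\<bar>
     = (L - h * M)\<^sup>2 / M * \<bar>cross2 v n\<bar>"
    using M(2) by (simp add: abs_mult power2_eq_square abs_mult_self_eq)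
  then show "triangle_area (meet (line_dir A1 V1) (line_dir A2 V2))
           (meet (line_dir P v) (line_dir A1 V1)) (meet (line_dir P v) (line_dir A2 V2))
         = \<bar>cross2 v n\<bar> / 2 * ((L - h * M)\<^sup>2 / M)"
    unfolding B B1 B2 triangle_area_cross2 by (simp add: mult_ac)
qed

section \<open>Arcs of positive curvature\<close>

lemma inverse_has_real_derivative:
  fixes f g :: "real \<Rightarrow> real"
  assumes "open S" "x \<in> S" and gf: "\<And>z. z \<in> S \<Longrightarrow> g (f z) = z"
    and der: "\<And>z. z \<in> S \<Longrightarrow> (f has_real_derivative f' z) (at z)" and "f' x \<noteq> 0"
  shows "(g has_real_derivative 1 / f' x) (at (f x))"
proof -
  have "continuous_on S f" using der DERIV_isCont continuous_at_imp_continuous_on by blast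
  then have "(g has_derivative (*) (1 / f' x)) (at (f x))"
    by (intro has_derivative_inverse_strong[where S = S and f = f, OF assms(1,2)] gf)
      (use der[OF assms(2)] assms(5) in \<open>auto simp: has_field_derivative_def o_def id_def\<close>)
  then show ?thesis by (simp add: has_field_derivative_def)
qed

text \<open>A second order Taylor expansion at a critical zero.\<close>

lemma second_order_quotient:
  fixes f :: "real \<Rightarrow> real"
  assumes f: "\<forall>\<^sub>F s in nhds t. (f has_real_derivative f' s) (at s)"
    and f': "(f' has_real_derivative c) (at t)" and 0: "f t = 0" "f' t = 0"
  shows "((\<lambda>s. f s / (s - t)\<^sup>2) \<longlongrightarrow> c / 2) (at t)"
proof (rule lhopital)
  have "isCont f t" using eventually_nhds_x_imp_x[OF f] DERIV_isCont by blast
  then show "f \<midarrow>t\<rightarrow> 0" using 0 by (simp add: isCont_def)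
  show "((\<lambda>s. (s - t)\<^sup>2) \<longlongrightarrow> 0) (at t)" by (auto intro!: tendsto_eq_intros)
  show "\<forall>\<^sub>F s in at t. (s - t)\<^sup>2 \<noteq> 0" "\<forall>\<^sub>F s in at t. 2 * (s - t) \<noteq> 0"
    by (auto simp: eventually_at_filter)
  show "\<forall>\<^sub>F s in at t. (f has_real_derivative f' s) (at s)"
    using f by (rule eventually_nhds_conv_at[THEN iffD1, THEN conjunct1])
  show "\<forall>\<^sub>F s in at t. ((\<lambda>s. (s - t)\<^sup>2) has_real_derivative 2 * (s - t)) (at s)"
    by (auto intro!: always_eventually derivative_eq_intros)
  have "((\<lambda>s. (f' s - f' t) / (s - t)) \<longlongrightarrow> c) (at t)"
    using f' by (simp add: has_field_derivative_iff)
  then have "((\<lambda>s. (f' s - f' t) / (s - t) / 2) \<longlongrightarrow> c / 2) (at t)"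
    by (rule tendsto_divide) auto
  then show "((\<lambda>s. f' s / (2 * (s - t))) \<longlongrightarrow> c / 2) (at t)"
    by (simp add: 0 mult.commute)
qed

text \<open>The working hypotheses: a simple three times differentiable curve \<open>X\<close> with derivatives \<open>V\<close>,
  \<open>W\<close>, \<open>Z\<close>, whose trace lies on the side of each tangent line into which the acceleration
  points. The sign \<open>\<epsilon>\<close> records whether this is the left or the right side of the curve; by
  continuity it is the same at all points.\<close>

locale convex_arc =
  fixes X V W Z :: "real \<Rightarrow> real^2" and I :: "real set" and \<epsilon> :: real
  assumes open_I: "open I" and interval_I: "is_interval I" and nonempty_I: "I \<noteq> {}"
    and X_deriv: "\<And>t. t \<in> I \<Longrightarrow> (X has_vector_derivative V t) (at t)"
    and V_deriv: "\<And>t. t \<in> I \<Longrightarrow> (V has_vector_derivative W t) (at t)"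
    and W_deriv: "\<And>t. t \<in> I \<Longrightarrow> (W has_vector_derivative Z t) (at t)"
    and eps: "\<epsilon> = 1 \<or> \<epsilon> = -1"
    and curved: "\<And>t. t \<in> I \<Longrightarrow> \<epsilon> * cross2 (V t) (W t) > 0"
    and inj_X: "inj_on X I"
    and support: "\<And>t s. t \<in> I \<Longrightarrow> s \<in> I \<Longrightarrow> \<epsilon> * cross2 (V t) (X s - X t) \<ge> 0"

text \<open>If velocity and acceleration of \<open>X\<close> are parallel at \<open>t\<close>, then the unit tangent vector is
  stationary there, so the acceleration of the arclength parametrization vanishes. Only this
  consequence of positive curvature is needed: the sign of the curvature follows from
  convexity.\<close>

lemma arclength_curvature_nonzero_imp:
  assumes I: "open I" "t \<in> I"
    and X: "\<And>t. t \<in> I \<Longrightarrow> (X has_vector_derivative V t) (at t)"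
    and V: "\<And>t. t \<in> I \<Longrightarrow> (V has_vector_derivative W t) (at t)" and V0: "\<And>t. t \<in> I \<Longrightarrow> V t \<noteq> 0"
    and s: "\<And>t. t \<in> I \<Longrightarrow> (\<sigma> has_real_derivative norm (V t)) (at t)" and int: "is_interval I"
    and Y: "\<And>t. t \<in> I \<Longrightarrow> X t = Y (\<sigma> t)" and nz: "velocity (velocity Y) (\<sigma> t) \<noteq> 0"
  shows "cross2 (V t) (W t) \<noteq> 0"
proof
  assume c0: "cross2 (V t) (W t) = 0"
  have mono: "\<sigma> a < \<sigma> b" if "a \<in> I" "b \<in> I" "a < b" for a b
  proof (rule DERIV_pos_imp_increasing[OF that(3)])
    fix x assume "a \<le> x" "x \<le> b"
    then have "x \<in> I" using mem_is_interval_1_I[OF int that(1,2)] by blast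
    then show "\<exists>y. (\<sigma> has_real_derivative y) (at x) \<and> 0 < y" using s[of x] V0[of x] by auto
  qed
  have inj: "inj_on \<sigma> I"
  proof (rule inj_onI)
    fix a b assume "a \<in> I" "b \<in> I" "\<sigma> a = \<sigma> b"
    then show "a = b" using mono[of a b] mono[of b a] by (cases a b rule: linorder_cases) auto
  qed
  define \<tau> where "\<tau> = the_inv_into I \<sigma>"
  have \<tau>\<sigma>: "\<tau> (\<sigma> z) = z" if "z \<in> I" for z
    unfolding \<tau>_def by (rule the_inv_into_f_f[OF inj that])
  have \<tau>: "(\<tau> has_real_derivative 1 / norm (V z)) (at (\<sigma> z))" if "z \<in> I" for z
    using inverse_has_real_derivative[where S = I and x = z and f = \<sigma> and g = \<tau>
        and f' = "\<lambda>z. norm (V z)"] I(1) that \<tau>\<sigma> s V0[OF that] by simp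
  have "continuous_on I \<sigma>"
    by (rule continuous_at_imp_continuous_on) (auto intro: DERIV_isCont[OF s])
  then have J: "open (\<sigma> ` I)"
    using injective_eq_1d_open_map_UNIV[of I \<sigma>] int inj I(1) by simp
  have vY: "velocity Y s = (1 / norm (V (\<tau> s))) *\<^sub>R V (\<tau> s)" if "s \<in> \<sigma> ` I" for s
  proof -
    from that obtain z where z: "z \<in> I" "s = \<sigma> z" by blast
    have "(X \<circ> \<tau> has_vector_derivative (1 / norm (V z)) *\<^sub>R V z) (at s)"
      by (rule vector_diff_chain_at)
        (use \<tau>[OF z(1)] X[OF z(1)] z \<tau>\<sigma> in \<open>simp_all add: has_real_derivative_iff_has_vector_derivative\<close>)
    then have "(Y has_vector_derivative (1 / norm (V z)) *\<^sub>R V z) (at s)"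
      by (rule has_vector_derivative_transform_within_open[OF _ J that]) (auto simp: Y \<tau>\<sigma>)
    then show ?thesis using z \<tau>\<sigma> by (simp add: vector_derivative_at)
  qed
  define T where "T z = (1 / norm (V z)) *\<^sub>R V z" for z
  have Vt: "(V has_derivative (\<lambda>h. h *\<^sub>R W t)) (at t)"
    using V[OF I(2)] by (simp add: has_vector_derivative_def)
  define k where "k = (V t \<bullet> W t) / (V t \<bullet> V t)"
  have Wk: "W t = k *\<^sub>R V t" unfolding k_def by (rule cross2_eq_0D[OF c0 V0[OF I(2)]])
  have n0: "norm (V t) > 0" "V t \<noteq> 0" using V0[OF I(2)] by auto
  have "((\<lambda>z. norm (V z)) has_derivative (\<lambda>h. (h *\<^sub>R W t) \<bullet> sgn (V t))) (at t)"
    using has_derivative_compose[OF Vt has_derivative_norm[OF n0(2)]]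
    by (simp add: inner_commute)
  moreover have "W t \<bullet> sgn (V t) = k * norm (V t)"
    unfolding Wk sgn_div_norm using n0 by (simp add: power2_norm_eq_inner[symmetric] power2_eq_square)
  ultimately have nV: "((\<lambda>z. norm (V z)) has_real_derivative k * norm (V t)) (at t)"
    unfolding has_field_derivative_def
    by (elim has_derivative_eq_rhs) (auto simp: mult_ac)
  have inv: "((\<lambda>z. 1 / norm (V z)) has_real_derivative - k / norm (V t)) (at t)"
    using DERIV_inverse_fun[OF nV] n0 by (simp add: inverse_eq_divide)
  have "(T has_vector_derivative (1 / norm (V t)) *\<^sub>R W t + (- k / norm (V t)) *\<^sub>R V t) (at t)"
    unfolding T_def by (rule has_vector_derivative_scaleR[OF inv V[OF I(2)]])
  then have T0: "(T has_vector_derivative 0) (at t)" by (simp add: Wk)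
  have d\<tau>: "(\<tau> has_vector_derivative 1 / norm (V t)) (at (\<sigma> t))"
    using \<tau>[OF I(2)] by (simp only: has_real_derivative_iff_has_vector_derivative)
  have dT: "(T has_vector_derivative 0) (at (\<tau> (\<sigma> t)))"
    using T0 by (simp only: \<tau>\<sigma>[OF I(2)])
  have TY: "(T \<circ> \<tau>) s = velocity Y s" if "s \<in> \<sigma> ` I" for s
    using vY[OF that] by (simp add: T_def)
  have "(T \<circ> \<tau> has_vector_derivative 0) (at (\<sigma> t))"
    using vector_diff_chain_at[OF d\<tau> dT] by simp
  then have "(velocity Y has_vector_derivative 0) (at (\<sigma> t))"
    by (rule has_vector_derivative_transform_within_open[OF _ J _ TY]) (use I(2) in auto)
  then show False using nz by (simp add: vector_derivative_at)
qed

lemma normal_eq_rot: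
  assumes "n \<bullet> v = 0" "v \<noteq> 0"
  shows "n = (cross2 v n / (v \<bullet> v)) *\<^sub>R rot v"
  using frame_expand[OF assms(2), of n] assms(1) by (simp add: inner_commute)

lemma strictly_convex_curve_imp_convex_arc:
  assumes "strictly_convex_curve X I"
  obtains \<epsilon> where "convex_arc X (velocity X) (velocity (velocity X))
                  (velocity (velocity (velocity X))) I \<epsilon>"
proof -
  define V W Z where "V = velocity X" and "W = velocity V" and "Z = velocity W"
  have cc: "convex_curve X I" and inj: "inj_on X I" using assms by (auto simp: strictly_convex_curve_def)
  then have reg: "regular_C3_curve X I" and supp: "\<And>t. t \<in> I \<Longrightarrow> \<exists>n. supporting_normal X I t n"
    by (auto simp: convex_curve_def)
  have I: "open I" "is_interval I" "I \<noteq> {}" and V0: "\<And>t. t \<in> I \<Longrightarrow> V t \<noteq> 0"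
    using reg by (auto simp: regular_C3_curve_def V_def)
  have "class_C_on (Suc (Suc (Suc 0))) X I"
    using reg by (simp add: regular_C3_curve_def numeral_3_eq_3)
  then have d: "(X has_vector_derivative V t) (at t)" "(V has_vector_derivative W t) (at t)"
      "(W has_vector_derivative Z t) (at t)" if "t \<in> I" for t
    using that unfolding V_def W_def Z_def by (auto simp: vector_derivative_works)
  obtain Y J where ap: "arclength_parametrization X I Y J"
      and k: "\<forall>s\<in>J. arclength_curvature Y J s > 0"
    using assms by (auto simp: strictly_convex_curve_def)
  obtain \<sigma> where \<sigma>: "\<And>t. t \<in> I \<Longrightarrow> (\<sigma> has_real_derivative norm (V t)) (at t)" "\<sigma> ` I = J"
      "\<And>t. t \<in> I \<Longrightarrow> X t = Y (\<sigma> t)"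
    using ap unfolding V_def by (auto simp: arclength_parametrization_def)
  have nz: "cross2 (V t) (W t) \<noteq> 0" if "t \<in> I" for t
  proof (rule arclength_curvature_nonzero_imp[where X = X and V = V and W = W and I = I
        and Y = Y and \<sigma> = \<sigma> and t = t])
    show "velocity (velocity Y) (\<sigma> t) \<noteq> 0"
      using k that \<sigma>(2) by (force simp: arclength_curvature_def)
  qed (simp_all add: I that d \<sigma> V0)
  have contV: "continuous_on I V" and contW: "continuous_on I W"
    using d(2,3) by (meson continuous_at_imp_continuous_on has_vector_derivative_continuous)+
  have cont: "continuous_on I (\<lambda>t. cross2 (V t) (W t))"
    by (rule cross2_continuous_on[OF contV contW])
  obtain \<epsilon> :: real where \<epsilon>: "\<epsilon> = 1 \<or> \<epsilon> = -1" "\<And>t. t \<in> I \<Longrightarrow> \<epsilon> * cross2 (V t) (W t) > 0"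
  proof -
    have "connected ((\<lambda>t. cross2 (V t) (W t)) ` I)"
      using connected_continuous_image[OF cont] I(2) is_interval_connected by blast
    then have iv: "is_interval ((\<lambda>t. cross2 (V t) (W t)) ` I)" by (simp add: is_interval_connected_1)
    have "(\<forall>t\<in>I. cross2 (V t) (W t) > 0) \<or> (\<forall>t\<in>I. cross2 (V t) (W t) < 0)"
    proof (rule ccontr)
      assume "\<not> ?thesis"
      then obtain a b where "a \<in> I" "b \<in> I" "cross2 (V a) (W a) \<le> 0" "0 \<le> cross2 (V b) (W b)"
        by (auto simp: not_less)
      then have "0 \<in> (\<lambda>t. cross2 (V t) (W t)) ` I" using mem_is_interval_1_I[OF iv, of "cross2 (V a) (W a)" "cross2 (V b) (W b)"] by blast
      then show False using nz by auto
    qed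
    then show thesis using that[of 1] that[of "-1"] by auto
  qed
  have sup: "\<epsilon> * cross2 (V t) (X s - X t) \<ge> 0" if t: "t \<in> I" "s \<in> I" for t s
  proof -
    obtain n where n: "norm n = 1" "n \<bullet> V t = 0" "\<And>s. s \<in> I \<Longrightarrow> 0 \<le> n \<bullet> (X s - X t)"
      using supp[OF t(1)] by (auto simp: supporting_normal_def V_def)
    define c where "c = cross2 (V t) n / (V t \<bullet> V t)"
    have nc: "n = c *\<^sub>R rot (V t)" unfolding c_def by (rule normal_eq_rot[OF n(2) V0[OF t(1)]])
    have c0: "c \<noteq> 0" using n(1) nc by auto
    have ni: "n \<bullet> z = c * cross2 (V t) z" for z unfolding nc by (simp add: rot_inner)
    have evI: "\<forall>\<^sub>F s in nhds t. s \<in> I" using I(1) t(1) eventually_nhds_in_open by blast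
    \<comment> \<open>the height over the tangent line has a minimum at \<open>t\<close>, so its second derivative is nonnegative\<close>
    have "((\<lambda>s. n \<bullet> (X s - X t) / (s - t)\<^sup>2) \<longlongrightarrow> (n \<bullet> W t) / 2) (at t)"
    proof (rule second_order_quotient)
      have "((\<lambda>s. n \<bullet> (X s - X t)) has_real_derivative n \<bullet> V s) (at s)" if "s \<in> I" for s
      proof (rule cross2_inner_has_real_derivative)
        show "((\<lambda>s. X s - X t) has_vector_derivative V s) (at s)"
          using has_vector_derivative_diff[OF d(1)[OF that] has_vector_derivative_const] by simp
      qed
      then show "\<forall>\<^sub>F s in nhds t. ((\<lambda>s. n \<bullet> (X s - X t)) has_real_derivative n \<bullet> V s) (at s)"
        using evI by (simp add: eventually_mono)
    qed (use cross2_inner_has_real_derivative(2)[OF d(2)[OF t(1)]] n(2) in auto)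
    moreover have "\<forall>\<^sub>F s in at t. 0 \<le> n \<bullet> (X s - X t) / (s - t)\<^sup>2"
      using evI by (auto simp: eventually_at_filter elim!: eventually_mono intro!: divide_nonneg_nonneg n(3))
    ultimately have "0 \<le> (n \<bullet> W t) / 2"
      by (rule tendsto_lowerbound) simp
    then have "0 \<le> c * cross2 (V t) (W t)" by (simp add: ni)
    then have ec: "\<epsilon> * c > 0"
      using \<epsilon>(1) \<epsilon>(2)[OF t(1)] c0 by (elim disjE) (simp_all add: zero_le_mult_iff)
    have "0 \<le> c * cross2 (V t) (X s - X t)" using n(3)[OF t(2)] by (simp add: ni)
    then show ?thesis
      using ec \<epsilon>(1) by (elim disjE) (simp_all add: zero_le_mult_iff)
  qed
  have "convex_arc X V W Z I \<epsilon>"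
    by (rule convex_arc.intro) (simp_all add: I d \<epsilon> inj sup)
  then show thesis using that unfolding V_def W_def Z_def by blast
qed

section \<open>Chords parallel to a tangent\<close>

context convex_arc
begin

text \<open>Coordinates at the point \<open>X t\<close>: the point \<open>X s\<close> is \<open>X t + \<xi> t s *\<^sub>R V t + H t s *\<^sub>R conormal t\<close>.
  The height \<open>H\<close> is not normalized, it is \<open>norm (V t)\<close> times the distance from the tangent line;
  correspondingly \<open>conormal t\<close> is the inner unit normal divided by \<open>norm (V t)\<close>. The primed
  functions are derivatives with respect to \<open>s\<close>, and \<open>D t\<close> is the second derivative of \<open>H t\<close>
  at \<open>t\<close>, the curvature up to a power of the speed.\<close>

definition H where "H t s = \<epsilon> * cross2 (V t) (X s - X t)"
definition H' where "H' t s = \<epsilon> * cross2 (V t) (V s)"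
definition \<xi> where "\<xi> t s = V t \<bullet> (X s - X t) / (V t \<bullet> V t)"
definition \<xi>' where "\<xi>' t s = V t \<bullet> V s / (V t \<bullet> V t)"
definition D where "D t = \<epsilon> * cross2 (V t) (W t)"
definition conormal where "conormal t = (\<epsilon> / (V t \<bullet> V t)) *\<^sub>R rot (V t)"

lemma eps2 [simp]: "\<epsilon> * \<epsilon> = 1" "\<epsilon> \<noteq> 0"
  using eps by auto

lemma V_nz: "t \<in> I \<Longrightarrow> V t \<noteq> 0"
  using curved by force

lemma D_pos: "t \<in> I \<Longrightarrow> D t > 0"
  unfolding D_def by (rule curved)

lemma at_base [simp]: "H t t = 0" "H' t t = 0" "\<xi> t t = 0" "t \<in> I \<Longrightarrow> \<xi>' t t = 1"
  using V_nz by (auto simp: H_def H'_def \<xi>_def \<xi>'_def)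

lemma X_diff_deriv: "s \<in> I \<Longrightarrow> ((\<lambda>s. X s - X t) has_vector_derivative V s) (at s)"
  using has_vector_derivative_diff[OF X_deriv has_vector_derivative_const] by simp

lemma H_deriv: "s \<in> I \<Longrightarrow> (H t has_real_derivative H' t s) (at s)"
  unfolding H_def H'_def
  by (intro DERIV_cmult cross2_inner_has_real_derivative X_diff_deriv)

lemma xi_deriv: "s \<in> I \<Longrightarrow> (\<xi> t has_real_derivative \<xi>' t s) (at s)"
  unfolding \<xi>_def \<xi>'_def
  by (intro DERIV_cdivide cross2_inner_has_real_derivative X_diff_deriv)

lemma H'_deriv: "s \<in> I \<Longrightarrow> (H' t has_real_derivative \<epsilon> * cross2 (V t) (W s)) (at s)"
  unfolding H'_def
  by (intro DERIV_cmult cross2_inner_has_real_derivative V_deriv)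

lemma xi'_cont: "s \<in> I \<Longrightarrow> isCont (\<xi>' t) s"
  unfolding \<xi>'_def
  by (rule DERIV_isCont[OF DERIV_cdivide[OF cross2_inner_has_real_derivative(2)[OF V_deriv]]])

lemma conormal_cross2: "t \<in> I \<Longrightarrow> cross2 (V t) (conormal t) = \<epsilon>"
  using V_nz by (simp add: conormal_def cross2_rot)

lemma frame_X: 
  assumes "t \<in> I"
  shows "X s - X t = \<xi> t s *\<^sub>R V t + H t s *\<^sub>R conormal t"
proof -
  have "H t s * (\<epsilon> / (V t \<bullet> V t)) = cross2 (V t) (X s - X t) / (V t \<bullet> V t)"
    using eps by (auto simp: H_def)
  then show ?thesis
    unfolding conormal_def \<xi>_def scaleR_scaleR by (metis frame_expand[OF V_nz[OF assms]])
qed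

lemma frame_V: 
  assumes "t \<in> I"
  shows "V s = \<xi>' t s *\<^sub>R V t + H' t s *\<^sub>R conormal t"
proof -
  have "H' t s * (\<epsilon> / (V t \<bullet> V t)) = cross2 (V t) (V s) / (V t \<bullet> V t)"
    using eps by (auto simp: H'_def)
  then show ?thesis
    unfolding conormal_def \<xi>'_def scaleR_scaleR by (metis frame_expand[OF V_nz[OF assms]])
qed

text \<open>The trace lies on one side of the tangent line at \<open>X r\<close>, in the coordinates at \<open>X t\<close>.\<close>

lemma support_in_frame:
  assumes "t \<in> I" "r \<in> I" "s \<in> I"
  shows "0 \<le> \<xi>' t r * (H t s - H t r) - H' t r * (\<xi> t s - \<xi> t r)"
proof -
  have e: "X s - X r = (\<xi> t s - \<xi> t r) *\<^sub>R V t + (H t s - H t r) *\<^sub>R conormal t"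
    using frame_X[OF assms(1), of s] frame_X[OF assms(1), of r] by (simp add: algebra_simps)
  have "cross2 (V r) (X s - X r) = cross2 (V t) (conormal t) *
      (\<xi>' t r * (H t s - H t r) - H' t r * (\<xi> t s - \<xi> t r))"
    unfolding e frame_V[OF assms(1), of r] using cross2_skew[of "conormal t" "V t"]
    by (simp add: cross2_add algebra_simps)
  then have "\<epsilon> * cross2 (V r) (X s - X r) =
      \<epsilon> * \<epsilon> * (\<xi>' t r * (H t s - H t r) - H' t r * (\<xi> t s - \<xi> t r))"
    unfolding conormal_cross2[OF assms(1)] by simp
  then show ?thesis using support[OF assms(2,3)] by simp
qed

text \<open>On the parameters within distance \<open>\<delta>\<close> of \<open>t\<close> the curve is a graph over its tangent line at \<open>t\<close>,
  falling before \<open>t\<close> and rising after \<open>t\<close>.\<close>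

definition graph_radius where
  "graph_radius t \<delta> \<longleftrightarrow> \<delta> > 0 \<and> {t - \<delta>..t + \<delta>} \<subseteq> I \<and> (\<forall>s\<in>{t - \<delta>..t + \<delta>}. \<xi>' t s > 0) \<and>
     (\<forall>s. t < s \<and> s \<le> t + \<delta> \<longrightarrow> H' t s > 0) \<and> (\<forall>s. t - \<delta> \<le> s \<and> s < t \<longrightarrow> H' t s < 0)"

lemma graph_radius_smaller: "graph_radius t \<delta> \<Longrightarrow> 0 < \<delta>' \<Longrightarrow> \<delta>' \<le> \<delta> \<Longrightarrow> graph_radius t \<delta>'"
  unfolding graph_radius_def by (auto simp: subset_iff)

lemma ex_graph_radius:
  assumes t: "t \<in> I"
  obtains \<delta> where "graph_radius t \<delta>"
proof -
  obtain d1 where d1: "d1 > 0" "\<And>s. dist s t < d1 \<Longrightarrow> s \<in> I"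
    using open_I t unfolding open_dist by blast
  have "\<forall>\<^sub>F s in nhds t. \<xi>' t s > 0"
    by (rule order_tendstoD[OF isCont_tendsto_compose[OF xi'_cont[OF t] filterlim_ident]]) (simp add: t)
  then obtain d2 where d2: "d2 > 0" "\<And>s. dist s t < d2 \<Longrightarrow> \<xi>' t s > 0"
    unfolding eventually_nhds_metric by blast
  note d = H'_deriv[OF t, of t] D_pos[OF t, unfolded D_def]
  obtain d3 where d3: "d3 > 0" "\<And>h. 0 < h \<Longrightarrow> h < d3 \<Longrightarrow> H' t t < H' t (t + h)"
    using DERIV_pos_inc_right[OF d] by blast
  obtain d4 where d4: "d4 > 0" "\<And>h. 0 < h \<Longrightarrow> h < d4 \<Longrightarrow> H' t (t - h) < H' t t"
    using DERIV_pos_inc_left[OF d] by blast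
  define \<delta> where "\<delta> = Min {d1, d2, d3, d4} / 2"
  have \<delta>: "\<delta> > 0" "\<delta> < d1" "\<delta> < d2" "\<delta> < d3" "\<delta> < d4"
    unfolding \<delta>_def using d1 d2 d3 d4 by (auto simp: min_def)
  have "graph_radius t \<delta>"
    unfolding graph_radius_def
  proof (intro conjI ballI allI impI subsetI)
    fix s assume "s \<in> {t - \<delta>..t + \<delta>}"
    then have "dist s t < d1" "dist s t < d2" using \<delta> by (auto simp: dist_real_def)
    then show "s \<in> I" "\<xi>' t s > 0" using d1 d2 by blast+
  next
    fix s assume "t < s \<and> s \<le> t + \<delta>"
    then show "H' t s > 0" using d3(2)[of "s - t"] \<delta> by auto
  next
    fix s assume "t - \<delta> \<le> s \<and> s < t"
    then show "H' t s < 0" using d4(2)[of "t - s"] \<delta> by auto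
  qed (fact \<delta>)
  then show thesis by (rule that)
qed

lemma graph_radius_mono:
  assumes "graph_radius t \<delta>"
  shows "t \<le> a \<Longrightarrow> a < b \<Longrightarrow> b \<le> t + \<delta> \<Longrightarrow> H t a < H t b"
    and "t - \<delta> \<le> a \<Longrightarrow> a < b \<Longrightarrow> b \<le> t \<Longrightarrow> H t b < H t a"
    and "t - \<delta> \<le> a \<Longrightarrow> a < b \<Longrightarrow> b \<le> t + \<delta> \<Longrightarrow> \<xi> t a < \<xi> t b"
    and "continuous_on {t - \<delta>..t + \<delta>} (H t)" "continuous_on {t - \<delta>..t + \<delta>} (\<xi> t)"
proof -
  have I: "s \<in> I" if "t - \<delta> \<le> s" "s \<le> t + \<delta>" for s
    using assms that by (auto simp: graph_radius_def)
  show cH: "continuous_on {t - \<delta>..t + \<delta>} (H t)"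
    by (intro continuous_at_imp_continuous_on ballI DERIV_isCont[OF H_deriv] I) auto
  show "continuous_on {t - \<delta>..t + \<delta>} (\<xi> t)"
    by (intro continuous_at_imp_continuous_on ballI DERIV_isCont[OF xi_deriv] I) auto
  show "H t a < H t b" if "t \<le> a" "a < b" "b \<le> t + \<delta>"
  proof (rule DERIV_pos_imp_increasing_open[OF that(2)])
    fix x assume "a < x" "x < b"
    then have "x \<in> I" "H' t x > 0" using that assms by (auto simp: graph_radius_def)
    then show "\<exists>y. (H t has_real_derivative y) (at x) \<and> 0 < y" using H_deriv by blast
  qed (rule continuous_on_subset[OF cH], use that assms in \<open>auto simp: graph_radius_def\<close>)
  show "H t b < H t a" if "t - \<delta> \<le> a" "a < b" "b \<le> t"
  proof (rule DERIV_neg_imp_decreasing_open[OF that(2)])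
    fix x assume "a < x" "x < b"
    then have "x \<in> I" "H' t x < 0" using that assms by (auto simp: graph_radius_def)
    then show "\<exists>y. (H t has_real_derivative y) (at x) \<and> y < 0" using H_deriv by blast
  qed (rule continuous_on_subset[OF cH], use that assms in \<open>auto simp: graph_radius_def\<close>)
  show "\<xi> t a < \<xi> t b" if "t - \<delta> \<le> a" "a < b" "b \<le> t + \<delta>"
  proof (rule DERIV_pos_imp_increasing[OF that(2)])
    fix x assume "a \<le> x" "x \<le> b"
    then have "x \<in> I" "\<xi>' t x > 0" using that assms by (auto simp: graph_radius_def)
    then show "\<exists>y. (\<xi> t has_real_derivative y) (at x) \<and> 0 < y" using xi_deriv by blast
  qed
qed

text \<open>Points of small height belong to the local graph. A point outside the \<open>\<xi>\<close>-range of the graph is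
  kept up by the tangent lines at the two ends of the graph. A point over that range lies on or
  above the graph. Strictly above it, but below both ends, it would be an interior point of the
  triangle spanned by the two ends and the point of the graph below it, and then its tangent
  line could not have the whole trace on one side.\<close>

lemma low_points_near:
  assumes t: "t \<in> I" and gr: "graph_radius t \<delta>" and s: "s \<in> I"
    and low: "H t s < H t (t - \<delta>)" "H t s < H t (t + \<delta>)"
  shows "t - \<delta> < s" "s < t + \<delta>"
proof -
  define p q where "p = t + \<delta>" and "q = t - \<delta>"
  have \<delta>: "\<delta> > 0" using gr by (simp add: graph_radius_def)
  have pI: "p \<in> I" and qI: "q \<in> I" using gr by (auto simp: graph_radius_def p_def q_def subset_iff)
  have dp: "\<xi>' t p > 0" "H' t p > 0" and dq: "\<xi>' t q > 0" "H' t q < 0"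
    using gr \<delta> by (auto simp: graph_radius_def p_def q_def)
  have "\<xi> t s < \<xi> t p"
  proof (rule ccontr)
    assume "\<not> ?thesis"
    then have "H' t p * (\<xi> t s - \<xi> t p) \<ge> 0" using dp by simp
    moreover have "\<xi>' t p * (H t s - H t p) < 0" using dp low by (simp add: mult_pos_neg p_def)
    ultimately show False using support_in_frame[OF t pI s] by linarith
  qed
  have "\<xi> t q < \<xi> t s"
  proof (rule ccontr)
    assume "\<not> ?thesis"
    then have "H' t q * (\<xi> t s - \<xi> t q) \<ge> 0" using dq by (simp add: mult_nonpos_nonpos)
    moreover have "\<xi>' t q * (H t s - H t q) < 0" using dq low by (simp add: mult_pos_neg q_def)
    ultimately show False using support_in_frame[OF t qI s] by linarith
  qed
  obtain r where r: "q \<le> r" "r \<le> p" "\<xi> t r = \<xi> t s"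
    using IVT'[of "\<xi> t" q "\<xi> t s" p] \<open>\<xi> t s < \<xi> t p\<close> \<open>\<xi> t q < \<xi> t s\<close> graph_radius_mono(5)[OF gr] \<delta>
    unfolding p_def q_def by auto
  have rI: "r \<in> I" and dr: "\<xi>' t r > 0" using r gr by (auto simp: graph_radius_def p_def q_def)
  have "H t r \<le> H t s" using support_in_frame[OF t rI s] r(3) dr by (simp add: zero_le_mult_iff)
  have "H t r = H t s"
  proof (rule ccontr)
    assume "\<not> ?thesis"
    then have rs: "H t r < H t s" using \<open>H t r \<le> H t s\<close> by simp
    have "0 \<le> \<xi>' t s * (H t r - H t s)" using support_in_frame[OF t s rI] r(3) by simp
    then have g: "\<xi>' t s \<le> 0" using rs by (simp add: zero_le_mult_iff)
    have P: "\<xi>' t s * (H t p - H t s) \<le> 0" "\<xi>' t s * (H t q - H t s) \<le> 0"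
      using g low by (simp_all add: mult_nonpos_nonneg p_def q_def)
    have "0 \<le> - H' t s * (\<xi> t p - \<xi> t s)" "0 \<le> - H' t s * (\<xi> t q - \<xi> t s)"
      using support_in_frame[OF t s pI] support_in_frame[OF t s qI] P by auto
    then have h0: "H' t s = 0"
      using \<open>\<xi> t s < \<xi> t p\<close> \<open>\<xi> t q < \<xi> t s\<close> by (auto simp: mult_le_0_iff)
    have "0 \<le> \<xi>' t s * (H t p - H t s)" using support_in_frame[OF t s pI] h0 by simp
    then have "\<xi>' t s = 0" using g low by (auto simp: zero_le_mult_iff p_def)
    then show False using frame_V[OF t, of s] h0 V_nz[OF s] by simp
  qed
  then have "X r = X s" using r(3) frame_X[OF t, of r] frame_X[OF t, of s] by (metis diff_add_cancel)
  then have rs: "r = s" using inj_X rI s by (auto dest: inj_onD)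
  have "s \<noteq> p" "s \<noteq> q" using low by (auto simp: p_def q_def)
  then show "t - \<delta> < s" "s < t + \<delta>" using r rs by (auto simp: p_def q_def)
qed

text \<open>The points at height \<open>c\<close> over the tangent line at \<open>t\<close> are those at \<open>s1 < t\<close> and \<open>s2 > t\<close>.\<close>

definition chord where
  "chord t c s1 s2 \<longleftrightarrow> s1 < t \<and> t < s2 \<and> {s \<in> I. H t s = c} = {s1, s2}"

lemma ex_chord:
  assumes t: "t \<in> I" and gr: "graph_radius t \<delta>" 
    and c: "0 < c" "c < H t (t - \<delta>)" "c < H t (t + \<delta>)"
  obtains s1 s2 where "chord t c s1 s2" "t - \<delta> < s1" "s2 < t + \<delta>"
proof -
  have \<delta>: "\<delta> > 0" using gr by (simp add: graph_radius_def)
  have I: "s \<in> I" if "t - \<delta> \<le> s" "s \<le> t + \<delta>" for s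
    using gr that by (auto simp: graph_radius_def)
  obtain s2 where s2: "t \<le> s2" "s2 \<le> t + \<delta>" "H t s2 = c"
    using IVT'[of "H t" t c "t + \<delta>"] c \<delta> continuous_on_subset[OF graph_radius_mono(4)[OF gr], of "{t..t + \<delta>}"]
    by auto
  obtain s1 where s1: "t - \<delta> \<le> s1" "s1 \<le> t" "H t s1 = c"
    using IVT2'[of "H t" t c "t - \<delta>"] c \<delta> continuous_on_subset[OF graph_radius_mono(4)[OF gr], of "{t - \<delta>..t}"]
    by auto
  have ne: "s2 \<noteq> t" "s1 \<noteq> t" "s1 \<noteq> t - \<delta>" "s2 \<noteq> t + \<delta>" using s1 s2 c by auto
  have "s = s1 \<or> s = s2" if s: "s \<in> I" "H t s = c" for s
  proof -
    have b: "t - \<delta> < s" "s < t + \<delta>"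
      using low_points_near[OF t gr s(1)] s c by auto
    show ?thesis
    proof (cases "s \<le> t")
      case True
      then show ?thesis using graph_radius_mono(2)[OF gr, of s s1] graph_radius_mono(2)[OF gr, of s1 s] b s1 s
        by (cases s s1 rule: linorder_cases) auto
    next
      case False
      then show ?thesis using graph_radius_mono(1)[OF gr, of s s2] graph_radius_mono(1)[OF gr, of s2 s] b s2 s
        by (cases s s2 rule: linorder_cases) auto
    qed
  qed
  then have "{s \<in> I. H t s = c} = {s1, s2}" using I s1 s2 \<delta> by auto
  then have "chord t c s1 s2" using s1 s2 ne by (auto simp: chord_def)
  then show thesis using that s1 s2 ne by force
qed

lemma chordD:
  assumes "chord t c s1 s2"
  shows "s1 < t" "t < s2" "s1 \<in> I" "s2 \<in> I" "H t s1 = c" "H t s2 = c"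
  using assms unfolding chord_def by auto

end

section \<open>The two areas and their limits\<close>

context convex_arc
begin

lemma velocity_X: "t \<in> I \<Longrightarrow> velocity X t = V t"
  using X_deriv by (simp add: vector_derivative_at)

lemma convex_side_normal_X:
  assumes t: "t \<in> I"
  shows "convex_side_normal X I t = (\<epsilon> / norm (V t)) *\<^sub>R rot (V t)"
  unfolding convex_side_normal_def
proof (rule the_equality)
  let ?n = "(\<epsilon> / norm (V t)) *\<^sub>R rot (V t)"
  have "0 \<le> ?n \<bullet> (X s - X t)" if "s \<in> I" for s
    using support[OF t that] by (simp add: rot_inner)
  then show "supporting_normal X I t ?n"
    using V_nz[OF t] eps by (auto simp: supporting_normal_def velocity_X[OF t] rot_inner rot_norm)
  fix n assume n: "supporting_normal X I t n"
  define c where "c = cross2 (V t) n / (V t \<bullet> V t)"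
  have nc: "n = c *\<^sub>R rot (V t)"
    unfolding c_def using n V_nz[OF t] by (intro normal_eq_rot) (auto simp: supporting_normal_def velocity_X[OF t])
  have "\<bar>c\<bar> * norm (V t) = 1" using n by (simp add: supporting_normal_def nc rot_norm)
  then have ca: "\<bar>c\<bar> = 1 / norm (V t)" using V_nz[OF t] by (simp add: field_simps)
  obtain \<delta> where gr: "graph_radius t \<delta>" using ex_graph_radius[OF t] .
  then have "t + \<delta> \<in> I" "H t t < H t (t + \<delta>)"
    using graph_radius_mono(1)[OF gr, of t "t + \<delta>"] by (auto simp: graph_radius_def)
  then have "0 \<le> n \<bullet> (X (t + \<delta>) - X t)" "0 < \<epsilon> * cross2 (V t) (X (t + \<delta>) - X t)"
    using n by (auto simp: supporting_normal_def H_def)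
  then have "0 \<le> \<epsilon> * c" using eps unfolding nc by (auto simp: rot_inner zero_le_mult_iff)
  then have "c = \<epsilon> / norm (V t)" using eps ca by auto
  then show "n = ?n" using nc by simp
qed

lemma in_chord_line_iff:
  assumes t: "t \<in> I"
  shows "X s \<in> chord_line X I t (c / norm (V t)) \<longleftrightarrow> H t s = c"
proof -
  define k where "k = c / norm (V t) * (\<epsilon> / norm (V t))"
  have n: "norm (V t) * norm (V t) = V t \<bullet> V t" by (simp add: power2_norm_eq_inner[symmetric] power2_eq_square)
  have "k * (V t \<bullet> V t) = c * \<epsilon>" using V_nz[OF t] by (simp add: k_def n[symmetric])
  moreover have "X s \<in> chord_line X I t (c / norm (V t)) \<longleftrightarrow> cross2 (V t) (X s - (X t + k *\<^sub>R rot (V t))) = 0"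
    unfolding chord_line_def convex_side_normal_X[OF t] velocity_X[OF t] in_line_dir_iff_cross2[OF V_nz[OF t]]
    by (simp add: k_def)
  moreover have "cross2 (V t) (X s - (X t + k *\<^sub>R rot (V t))) = cross2 (V t) (X s - X t) - k * (V t \<bullet> V t)"
    by (simp add: cross2_add cross2_rot)
  ultimately show ?thesis using eps unfolding H_def by auto
qed

lemma chord_params_eq:
  assumes t: "t \<in> I" and ch: "chord t c s1 s2"
  shows "chord_params X I t (c / norm (V t)) = (s1, s2)"
proof -
  have e: "{s \<in> I. X s \<in> chord_line X I t (c / norm (V t))} = {s1, s2}"
    using ch by (simp add: in_chord_line_iff[OF t] chord_def)
  have lt: "s1 < s2" using ch by (simp add: chord_def)
  show ?thesis
    unfolding chord_params_def e
  proof (rule the_equality)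
    show "case (s1, s2) of (a, b) \<Rightarrow> a < b \<and> {s1, s2} = {a, b}" using lt by simp
    fix p assume "case p of (a, b) \<Rightarrow> a < b \<and> {s1, s2} = {a, b}"
    then show "p = (s1, s2)" using lt by (cases p) (auto simp: doubleton_eq_iff)
  qed
qed

text \<open>For the endpoints \<open>a\<close>, \<open>b\<close> of a chord: \<open>width\<close> is its length in units of the velocity, and
  \<open>slope_gap\<close> is the difference of the inverse slopes of the curve at the two endpoints, which
  is the derivative of the width with respect to the height.\<close>

definition slope_gap where "slope_gap t a b = \<xi>' t b / H' t b - \<xi>' t a / H' t a"
definition width where "width t a b = \<xi> t b - \<xi> t a"

lemma chord_areas:
  assumes t: "t \<in> I" and gr: "graph_radius t \<delta>" and ch: "chord t c s1 s2"
    and s: "t - \<delta> < s1" "s2 < t + \<delta>" and c: "c > 0"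
  shows "width t s1 s2 > 0" "slope_gap t s1 s2 > 0"
    and "T_area X I t (c / norm (V t)) = 1/2 * (c * width t s1 s2)"
    and "U_area X I t (c / norm (V t)) = 1/2 * ((width t s1 s2 - c * slope_gap t s1 s2)\<^sup>2 / slope_gap t s1 s2)"
proof -
  note chD = chordD[OF ch]
  have dx: "\<xi>' t s1 > 0" "\<xi>' t s2 > 0" and dH: "H' t s1 < 0" "H' t s2 > 0"
    using gr chD s by (auto simp: graph_radius_def)
  show L: "width t s1 s2 > 0"
    unfolding width_def using graph_radius_mono(3)[OF gr, of s1 s2] s chD by simp
  have "\<xi>' t s1 / H' t s1 < 0" "\<xi>' t s2 / H' t s2 > 0" using dx dH by (auto simp: divide_pos_neg)
  then show M: "slope_gap t s1 s2 > 0" unfolding slope_gap_def by simp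
  have k: "\<bar>cross2 (V t) (conormal t)\<bar> = 1" using conormal_cross2[OF t] eps by auto
  have A: "X s1 = X t + c *\<^sub>R conormal t + \<xi> t s1 *\<^sub>R V t" "X s2 = X t + c *\<^sub>R conormal t + \<xi> t s2 *\<^sub>R V t"
    using frame_X[OF t, of s1] frame_X[OF t, of s2] chD by (simp_all add: algebra_simps)
  note ar = chord_triangle_areas[where v = "V t" and n = "conormal t" and P = "X t" and h = c
      and L = "width t s1 s2" and M = "slope_gap t s1 s2", OF _ c A frame_V[OF t, of s1] frame_V[OF t, of s2]
      _ _ _ L _ M]
  have eq: "cross2 (V t) (conormal t) \<noteq> 0" "H' t s1 \<noteq> 0" "H' t s2 \<noteq> 0" using k dH by auto
  show "T_area X I t (c / norm (V t)) = 1/2 * (c * width t s1 s2)"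
    using ar(1) eq k unfolding T_area_def chord_params_eq[OF t ch] by (simp add: width_def slope_gap_def)
  show "U_area X I t (c / norm (V t)) = 1/2 * ((width t s1 s2 - c * slope_gap t s1 s2)\<^sup>2 / slope_gap t s1 s2)"
    using ar(2) eq k
    unfolding U_area_def chord_params_eq[OF t ch] tangent_line_def Let_def prod.case velocity_X[OF t]
      velocity_X[OF chD(3)] velocity_X[OF chD(4)] by (simp add: width_def slope_gap_def)
qed

text \<open>The endpoints of the chord at height \<open>c\<close>; meaningful only when there is such a chord.\<close>

definition lo where "lo t c = fst (chord_params X I t (c / norm (V t)))"
definition hi where "hi t c = snd (chord_params X I t (c / norm (V t)))"

lemma chord_lo_hi:
  assumes "t \<in> I" "chord t c a b"
  shows "lo t c = a" "hi t c = b"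
  using chord_params_eq[OF assms] by (auto simp: lo_def hi_def)

lemma chord_lo_hi_near:
  assumes t: "t \<in> I" and gr: "graph_radius t \<delta>" and c: "0 < c" "c < min (H t (t - \<delta>)) (H t (t + \<delta>))"
  shows "chord t c (lo t c) (hi t c)" "t - \<delta> < lo t c" "hi t c < t + \<delta>"
proof -
  obtain s1 s2 where "chord t c s1 s2" "t - \<delta> < s1" "s2 < t + \<delta>"
    using ex_chord[OF t gr, of c] c by auto
  then show "chord t c (lo t c) (hi t c)" "t - \<delta> < lo t c" "hi t c < t + \<delta>"
    using chord_lo_hi[OF t] by auto
qed

lemma graph_radius_ends_pos:
  assumes gr: "graph_radius t \<delta>"
  shows "0 < min (H t (t - \<delta>)) (H t (t + \<delta>))"
  using graph_radius_mono(1)[OF gr, of t "t + \<delta>"] graph_radius_mono(2)[OF gr, of "t - \<delta>" t] gr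
  by (auto simp: graph_radius_def)

lemma eventually_chord:
  assumes t: "t \<in> I" and gr: "graph_radius t \<delta>"
  shows "\<forall>\<^sub>F c in at_right 0. 0 < c \<and> chord t c (lo t c) (hi t c) \<and> t - \<delta> < lo t c \<and> hi t c < t + \<delta>"
  unfolding eventually_at_right_field
  using graph_radius_ends_pos[OF gr] chord_lo_hi_near[OF t gr] by blast

lemma filterlim_lo_hi:
  assumes t: "t \<in> I"
  shows "filterlim (lo t) (at t) (at_right 0)" "filterlim (hi t) (at t) (at_right 0)"
proof -
  obtain \<delta> where gr: "graph_radius t \<delta>" using ex_graph_radius[OF t] .
  have ev: "\<forall>\<^sub>F c in at_right 0. lo t c \<noteq> t \<and> hi t c \<noteq> t \<and> dist (lo t c) t < e \<and> dist (hi t c) t < e"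
    if "e > 0" for e
  proof -
    have "graph_radius t (min \<delta> e)"
      by (rule graph_radius_smaller[OF gr]) (use gr that in \<open>auto simp: graph_radius_def\<close>)
    from eventually_chord[OF t this] show ?thesis
      by eventually_elim (auto simp: chord_def dist_real_def)
  qed
  have "(lo t \<longlongrightarrow> t) (at_right 0)" "(hi t \<longlongrightarrow> t) (at_right 0)"
    by (rule tendstoI, drule ev, erule eventually_mono, simp)+
  then show "filterlim (lo t) (at t) (at_right 0)" "filterlim (hi t) (at t) (at_right 0)"
    unfolding filterlim_at using ev[of 1] by (auto elim: eventually_mono)
qed

lemma difference_quotient_limits:
  assumes t: "t \<in> I"
  shows "((\<lambda>s. H t s / (s - t)\<^sup>2) \<longlongrightarrow> D t / 2) (at t)" 
    and "((\<lambda>s. H' t s / (s - t)) \<longlongrightarrow> D t) (at t)"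
    and "((\<lambda>s. \<xi> t s / (s - t)) \<longlongrightarrow> 1) (at t)" 
    and "(\<xi>' t \<longlongrightarrow> 1) (at t)"
proof -
  have ev: "\<forall>\<^sub>F s in nhds t. s \<in> I" using open_I t eventually_nhds_in_open by blast
  have dH': "(H' t has_real_derivative D t) (at t)" using H'_deriv[OF t] by (simp add: D_def)
  have "\<forall>\<^sub>F s in nhds t. (H t has_real_derivative H' t s) (at s)"
    using ev by (rule eventually_mono) (rule H_deriv)
  from second_order_quotient[OF this dH'] show "((\<lambda>s. H t s / (s - t)\<^sup>2) \<longlongrightarrow> D t / 2) (at t)"
    by simp
  show "((\<lambda>s. H' t s / (s - t)) \<longlongrightarrow> D t) (at t)"
    using dH' by (simp add: has_field_derivative_iff)
  show "((\<lambda>s. \<xi> t s / (s - t)) \<longlongrightarrow> 1) (at t)"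
    using xi_deriv[OF t, of t] t by (simp add: has_field_derivative_iff)
  show "(\<xi>' t \<longlongrightarrow> 1) (at t)" using xi'_cont[OF t, of t] t by (simp add: isCont_def)
qed

text \<open>The contributions of one endpoint to the limits below: the products \<open>\<phi> * \<xi>\<close> make up \<open>c\<close> times
  the slope gap, and \<open>\<psi> * c\<close> is the square of \<open>\<xi>\<close>.\<close>

definition \<phi> where "\<phi> t s = H t s * \<xi>' t s / (H' t s * \<xi> t s)"
definition \<psi> where "\<psi> t s = (\<xi> t s)\<^sup>2 / H t s"

lemma quotient_limits:
  assumes t: "t \<in> I"
  shows "(\<phi> t \<longlongrightarrow> 1 / 2) (at t)" "(\<psi> t \<longlongrightarrow> 2 / D t) (at t)"
proof -
  note q = difference_quotient_limits[OF t]
  have "((\<lambda>s. (H t s / (s - t)\<^sup>2) * \<xi>' t s / ((H' t s / (s - t)) * (\<xi> t s / (s - t)))) \<longlongrightarrow>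
      (D t / 2) * 1 / (D t * 1)) (at t)"
    by (intro tendsto_intros q) (use D_pos[OF t] in auto)
  moreover have "\<forall>\<^sub>F s in at t. (H t s / (s - t)\<^sup>2) * \<xi>' t s / ((H' t s / (s - t)) * (\<xi> t s / (s - t))) = \<phi> t s"
    by (auto simp: eventually_at_filter \<phi>_def power2_eq_square)
  ultimately show "(\<phi> t \<longlongrightarrow> 1 / 2) (at t)"
    using D_pos[OF t] by (simp add: tendsto_cong)
  have "((\<lambda>s. (\<xi> t s / (s - t))\<^sup>2 / (H t s / (s - t)\<^sup>2)) \<longlongrightarrow> 1\<^sup>2 / (D t / 2)) (at t)"
    by (intro tendsto_intros q) (use D_pos[OF t] in auto)
  moreover have "\<forall>\<^sub>F s in at t. (\<xi> t s / (s - t))\<^sup>2 / (H t s / (s - t)\<^sup>2) = \<psi> t s"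
    by (auto simp: eventually_at_filter \<psi>_def power_divide)
  ultimately show "(\<psi> t \<longlongrightarrow> 2 / D t) (at t)" by (simp add: tendsto_cong)
qed

text \<open>The width of the chord is asymptotic to \<open>sqrt (8 * c / D t)\<close>, and its logarithmic derivative
  with respect to \<open>c\<close> is asymptotic to \<open>1 / (2 * c)\<close>.\<close>

lemma chord_limits:
  assumes t: "t \<in> I"
  shows "((\<lambda>c. c * slope_gap t (lo t c) (hi t c) / width t (lo t c) (hi t c)) \<longlongrightarrow> 1 / 2) (at_right 0)"
    and "((\<lambda>c. (width t (lo t c) (hi t c))\<^sup>2 / c) \<longlongrightarrow> 8 / D t) (at_right 0)"
proof -
  obtain \<delta> where gr: "graph_radius t \<delta>" using ex_graph_radius[OF t] .
  define k where "k = sqrt (2 / D t)"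
  have k: "k > 0" "k\<^sup>2 = 2 / D t" using D_pos[OF t] by (auto simp: k_def)
  note ql = quotient_limits[OF t]
  note lh = filterlim_lo_hi[OF t]
  define p q where "p c = sqrt (\<psi> t (lo t c))" and "q c = sqrt (\<psi> t (hi t c))" for c
  have p: "(p \<longlongrightarrow> k) (at_right 0)" and q: "(q \<longlongrightarrow> k) (at_right 0)"
    unfolding p_def q_def k_def
    by (intro tendsto_real_sqrt filterlim_compose[OF ql(2)] lh)+
  have f: "((\<lambda>c. \<phi> t (lo t c)) \<longlongrightarrow> 1/2) (at_right 0)" "((\<lambda>c. \<phi> t (hi t c)) \<longlongrightarrow> 1/2) (at_right 0)"
    by (intro filterlim_compose[OF ql(1)] lh)+
  have ev: "\<forall>\<^sub>F c in at_right 0. c > 0 \<and> width t (lo t c) (hi t c) = sqrt c * (p c + q c) \<and>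
      c * slope_gap t (lo t c) (hi t c) = sqrt c * (\<phi> t (lo t c) * p c + \<phi> t (hi t c) * q c)"
    using eventually_chord[OF t gr]
  proof eventually_elim
    case (elim c)
    let ?a = "lo t c" and ?b = "hi t c"
    have c: "c > 0" and ch: "chord t c ?a ?b" and r: "t - \<delta> < ?a" "?b < t + \<delta>" using elim by auto
    note chD = chordD[OF ch]
    have x: "\<xi> t ?a < 0" "0 < \<xi> t ?b"
      using graph_radius_mono(3)[OF gr, of ?a t] graph_radius_mono(3)[OF gr, of t ?b] chD r by auto
    have h: "H' t ?a < 0" "0 < H' t ?b" using gr chD r by (auto simp: graph_radius_def)
    have pq: "sqrt c * p c = - \<xi> t ?a" "sqrt c * q c = \<xi> t ?b"
      using x c chD by (simp_all add: p_def q_def \<psi>_def real_sqrt_divide)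
    have "c * slope_gap t ?a ?b = \<phi> t ?b * \<xi> t ?b - \<phi> t ?a * \<xi> t ?a"
      unfolding slope_gap_def \<phi>_def using x h chD by (simp add: field_simps)
    also have "\<dots> = sqrt c * (\<phi> t ?a * p c + \<phi> t ?b * q c)"
    proof -
      have "sqrt c * (\<phi> t ?a * p c + \<phi> t ?b * q c) = \<phi> t ?a * (sqrt c * p c) + \<phi> t ?b * (sqrt c * q c)"
        by (simp add: algebra_simps)
      then show ?thesis unfolding pq by simp
    qed
    finally show ?case using c pq by (simp add: width_def algebra_simps)
  qed
  have "((\<lambda>c. (\<phi> t (lo t c) * p c + \<phi> t (hi t c) * q c) / (p c + q c)) \<longlongrightarrow> (1/2 * k + 1/2 * k) / (k + k)) (at_right 0)"
    by (intro tendsto_intros p q f) (use k in auto)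
  moreover have "\<forall>\<^sub>F c in at_right 0. (\<phi> t (lo t c) * p c + \<phi> t (hi t c) * q c) / (p c + q c) =
      c * slope_gap t (lo t c) (hi t c) / width t (lo t c) (hi t c)"
    using ev by eventually_elim simp
  ultimately show "((\<lambda>c. c * slope_gap t (lo t c) (hi t c) / width t (lo t c) (hi t c)) \<longlongrightarrow> 1 / 2) (at_right 0)"
    using k by (simp add: tendsto_cong)
  have "((\<lambda>c. (p c + q c)\<^sup>2) \<longlongrightarrow> (k + k)\<^sup>2) (at_right 0)"
    by (intro tendsto_intros p q)
  moreover have "(k + k)\<^sup>2 = 8 / D t" using k(2) by (simp add: power2_eq_square algebra_simps)
  moreover have "\<forall>\<^sub>F c in at_right 0. (p c + q c)\<^sup>2 = (width t (lo t c) (hi t c))\<^sup>2 / c"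
    using ev by eventually_elim (auto simp: power_mult_distrib)
  ultimately show "((\<lambda>c. (width t (lo t c) (hi t c))\<^sup>2 / c) \<longlongrightarrow> 8 / D t) (at_right 0)"
    by (simp add: tendsto_cong)
qed

end

section \<open>The condition on the areas as a condition on the chords\<close>

lemma eventually_at_right_0_scale:
  fixes k :: real
  assumes "k > 0"
  shows "(\<forall>\<^sub>F c in at_right 0. P (c / k)) \<longleftrightarrow> (\<forall>\<^sub>F h in at_right 0. P h)"
proof
  assume "\<forall>\<^sub>F c in at_right 0. P (c / k)"
  then obtain b where b: "b > 0" "\<And>c. 0 < c \<Longrightarrow> c < b \<Longrightarrow> P (c / k)" by (auto simp: eventually_at_right_field)
  have "P h" if "0 < h" "h < b / k" for h
    using b(2)[of "h * k"] that assms by (simp add: pos_less_divide_eq)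
  then show "\<forall>\<^sub>F h in at_right 0. P h"
    using b(1) assms unfolding eventually_at_right_field by (intro exI[of _ "b / k"]) auto
next
  assume "\<forall>\<^sub>F h in at_right 0. P h"
  then obtain b where b: "b > 0" "\<And>c. 0 < c \<Longrightarrow> c < b \<Longrightarrow> P c" by (auto simp: eventually_at_right_field)
  have "P (h / k)" if "0 < h" "h < b * k" for h
    using b(2)[of "h / k"] that assms by (simp add: pos_divide_less_eq)
  then show "\<forall>\<^sub>F c in at_right 0. P (c / k)"
    using b(1) assms unfolding eventually_at_right_field by (intro exI[of _ "b * k"]) auto
qed

lemma open_sublevel:
  fixes f :: "real \<Rightarrow> real"
  assumes "continuous_on {a..b} f" "a \<le> u" "v \<le> b"
  shows "open ({u<..<v} \<inter> f -` {..<m})"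
proof -
  have "{u<..<v} \<subseteq> {a..b}" using assms by auto
  then have "continuous_on {u<..<v} f" using assms(1) continuous_on_subset by blast
  then show ?thesis by (rule continuous_open_preimage) simp_all
qed

context convex_arc
begin

lemma lo_hi_deriv:
  assumes t: "t \<in> I" and gr: "graph_radius t \<delta>" and c: "0 < c" "c < min (H t (t - \<delta>)) (H t (t + \<delta>))"
  shows "(lo t has_real_derivative 1 / H' t (lo t c)) (at c)" "(hi t has_real_derivative 1 / H' t (hi t c)) (at c)"
proof -
  let ?m = "min (H t (t - \<delta>)) (H t (t + \<delta>))"
  have \<delta>: "\<delta> > 0" and I: "{t - \<delta>..t + \<delta>} \<subseteq> I" using gr by (auto simp: graph_radius_def)
  note ch = chord_lo_hi_near[OF t gr c]
  note chD = chordD[OF ch(1)]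
  have inv: "lo t (H t z) = z \<or> hi t (H t z) = z" "lo t (H t z) < t" "hi t (H t z) > t"
    if z: "z \<in> {t - \<delta><..<t + \<delta>}" "z \<noteq> t" "H t z < ?m" for z
  proof -
    have "0 < H t z"
      using graph_radius_mono(1)[OF gr, of t z] graph_radius_mono(2)[OF gr, of z t] z
      by (cases z t rule: linorder_cases) auto
    from chord_lo_hi_near(1)[OF t gr this z(3)] 
    have "chord t (H t z) (lo t (H t z)) (hi t (H t z))" .
    moreover have "z \<in> {s \<in> I. H t s = H t z}" using z I by auto
    ultimately show "lo t (H t z) = z \<or> hi t (H t z) = z" "lo t (H t z) < t" "hi t (H t z) > t"
      by (auto simp: chord_def set_eq_iff)
  qed
  have lo_facts: "t - \<delta> < lo t c" "lo t c < t" "H t (lo t c) < ?m"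
    and hi_facts: "t < hi t c" "hi t c < t + \<delta>" "H t (hi t c) < ?m"
    using ch(2,3) chD(1,2,5,6) c by simp_all
  have nz: "H' t (lo t c) < 0" "H' t (hi t c) > 0"
    using gr lo_facts hi_facts by (auto simp: graph_radius_def)
  have "(lo t has_real_derivative 1 / H' t (lo t c)) (at (H t (lo t c)))"
  proof (rule inverse_has_real_derivative[where S = "{t - \<delta><..<t} \<inter> H t -` {..<?m}"
        and f = "H t" and g = "lo t" and f' = "H' t" and x = "lo t c"])
    show "open ({t - \<delta><..<t} \<inter> H t -` {..<?m})" 
      by (rule open_sublevel[OF graph_radius_mono(4)[OF gr]]) (simp_all add: less_imp_le[OF \<delta>])
    show "lo t c \<in> {t - \<delta><..<t} \<inter> H t -` {..<?m}" using lo_facts by simp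
    show "H' t (lo t c) \<noteq> 0" using nz by simp
  next
    fix z assume z: "z \<in> {t - \<delta><..<t} \<inter> H t -` {..<?m}"
    then have "z \<in> I" using I \<delta> by auto
    then show "(H t has_real_derivative H' t z) (at z)" by (rule H_deriv)
    show "lo t (H t z) = z" using inv[of z] z \<delta> by auto
  qed
  then show "(lo t has_real_derivative 1 / H' t (lo t c)) (at c)" using chD by simp
  have "(hi t has_real_derivative 1 / H' t (hi t c)) (at (H t (hi t c)))"
  proof (rule inverse_has_real_derivative[where S = "{t<..<t + \<delta>} \<inter> H t -` {..<?m}"
        and f = "H t" and g = "hi t" and f' = "H' t" and x = "hi t c"])
    show "open ({t<..<t + \<delta>} \<inter> H t -` {..<?m})" 
      by (rule open_sublevel[OF graph_radius_mono(4)[OF gr]]) (simp_all add: less_imp_le[OF \<delta>])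
    show "hi t c \<in> {t<..<t + \<delta>} \<inter> H t -` {..<?m}" using hi_facts by simp
    show "H' t (hi t c) \<noteq> 0" using nz by simp
  next
    fix z assume z: "z \<in> {t<..<t + \<delta>} \<inter> H t -` {..<?m}"
    then have "z \<in> I" using I \<delta> by auto
    then show "(H t has_real_derivative H' t z) (at z)" by (rule H_deriv)
    show "hi t (H t z) = z" using inv[of z] z \<delta> by auto
  qed
  then show "(hi t has_real_derivative 1 / H' t (hi t c)) (at c)" using chD by simp
qed

text \<open>The derivative of the logarithm of the width with respect to the logarithm of the height.\<close>

definition ratio where "ratio t c = c * slope_gap t (lo t c) (hi t c) / width t (lo t c) (hi t c)"

lemma eventually_areas:
  assumes t: "t \<in> I"
  shows "\<forall>\<^sub>F c in at_right 0. 0 < width t (lo t c) (hi t c) \<and>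
     (U_area X I t (c / norm (V t)) = k * T_area X I t (c / norm (V t)) \<longleftrightarrow> (1 - ratio t c)\<^sup>2 = k * ratio t c)"
proof -
  obtain \<delta> where gr: "graph_radius t \<delta>" using ex_graph_radius[OF t] .
  show ?thesis using eventually_chord[OF t gr]
  proof eventually_elim
    case (elim c)
    define w g where "w = width t (lo t c) (hi t c)" and "g = slope_gap t (lo t c) (hi t c)"
    have c: "c > 0" and ch: "chord t c (lo t c) (hi t c)" "t - \<delta> < lo t c" "hi t c < t + \<delta>"
      using elim by auto
    note ar = chord_areas[OF t gr ch c, folded w_def g_def]
    have w: "w > 0" and g: "g > 0" using ar by auto
    have "(1 - ratio t c)\<^sup>2 = k * ratio t c \<longleftrightarrow> w\<^sup>2 * (1 - c * g / w)\<^sup>2 = w\<^sup>2 * (k * (c * g / w))"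
      unfolding ratio_def w_def[symmetric] g_def[symmetric] using w by (subst mult_cancel_left) simp
    also have "w\<^sup>2 * (1 - c * g / w)\<^sup>2 = (w * (1 - c * g / w))\<^sup>2" by (simp add: power_mult_distrib)
    also have "w * (1 - c * g / w) = w - c * g" using w by (simp add: field_simps)
    also have "w\<^sup>2 * (k * (c * g / w)) = (k * (c * w)) * g" using w by (simp add: power2_eq_square)
    also have "(w - c * g)\<^sup>2 = (k * (c * w)) * g \<longleftrightarrow> (w - c * g)\<^sup>2 / g = k * (c * w)"
      using g by (simp add: field_simps)
    also have "\<dots> \<longleftrightarrow> 1/2 * ((w - c * g)\<^sup>2 / g) = k * (1/2 * (c * w))" by simp
    finally show ?case using w unfolding w_def[symmetric] ar(3,4) by blast
  qed
qed

lemma ratio_limit: "t \<in> I \<Longrightarrow> (ratio t \<longlongrightarrow> 1 / 2) (at_right 0)"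
  unfolding ratio_def by (rule chord_limits)

lemma eventually_area_ratio_iff:
  assumes t: "t \<in> I"
  shows "(\<forall>\<^sub>F h in at_right 0. U_area X I t h = k * T_area X I t h) \<longleftrightarrow>
     (\<forall>\<^sub>F c in at_right 0. (1 - ratio t c)\<^sup>2 = k * ratio t c)"
proof -
  have "norm (V t) > 0" using V_nz[OF t] by simp
  then have "(\<forall>\<^sub>F h in at_right 0. U_area X I t h = k * T_area X I t h) \<longleftrightarrow>
    (\<forall>\<^sub>F c in at_right 0. U_area X I t (c / norm (V t)) = k * T_area X I t (c / norm (V t)))"
    using eventually_at_right_0_scale[of "norm (V t)" "\<lambda>h. U_area X I t h = k * T_area X I t h"] by simp
  also have "\<dots> \<longleftrightarrow> (\<forall>\<^sub>F c in at_right 0. (1 - ratio t c)\<^sup>2 = k * ratio t c)"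
    by (rule eventually_cong[OF eventually_areas[OF t, of k]]) simp
  finally show ?thesis .
qed

lemma area_ratio_is_half:
  assumes t: "t \<in> I" and ev: "\<forall>\<^sub>F h in at_right 0. U_area X I t h = k * T_area X I t h"
  shows "k = 1 / 2"
proof -
  have "\<forall>\<^sub>F c in at_right 0. (1 - ratio t c)\<^sup>2 = k * ratio t c"
    using ev eventually_area_ratio_iff[OF t] by simp
  moreover have "((\<lambda>c. (1 - ratio t c)\<^sup>2) \<longlongrightarrow> (1 - 1/2)\<^sup>2) (at_right 0)"
    by (intro tendsto_intros ratio_limit t)
  ultimately have "((\<lambda>c. k * ratio t c) \<longlongrightarrow> (1 - 1/2)\<^sup>2) (at_right 0)" by (simp add: tendsto_cong)
  moreover have "((\<lambda>c. k * ratio t c) \<longlongrightarrow> k * (1/2)) (at_right 0)"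
    by (intro tendsto_intros ratio_limit t)
  ultimately have "(1 - 1/2)\<^sup>2 = k * (1/2)" by (rule tendsto_unique[rotated]) simp
  then show ?thesis by (simp add: power2_eq_square)
qed

text \<open>The quadratic equation for the ratio also has the root \<open>2\<close>, which is excluded by the limit
  \<open>1 / 2\<close>.\<close>

lemma half_area_iff_ratio:
  assumes t: "t \<in> I"
  shows "(\<forall>\<^sub>F h in at_right 0. U_area X I t h = 1/2 * T_area X I t h) \<longleftrightarrow>
     (\<forall>\<^sub>F c in at_right 0. ratio t c = 1/2)"
  unfolding eventually_area_ratio_iff[OF t]
proof (rule eventually_cong)
  show "\<forall>\<^sub>F c in at_right 0. ratio t c < 1" using order_tendstoD(2)[OF ratio_limit[OF t], of 1] by simp
  fix c assume "ratio t c < 1"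
  moreover have "(1 - ratio t c)\<^sup>2 = 1/2 * ratio t c \<longleftrightarrow> (ratio t c - 1/2) * (ratio t c - 2) = 0"
    by (simp add: power2_eq_square algebra_simps)
  ultimately show "(1 - ratio t c)\<^sup>2 = 1/2 * ratio t c \<longleftrightarrow> ratio t c = 1/2" by auto
qed

lemma width_of_half_ratio:
  assumes t: "t \<in> I" and ev: "\<forall>\<^sub>F c in at_right 0. ratio t c = 1/2"
  shows "\<forall>\<^sub>F c in at_right 0. (width t (lo t c) (hi t c))\<^sup>2 = 8 * c / D t"
proof -
  obtain \<delta> where gr: "graph_radius t \<delta>" using ex_graph_radius[OF t] .
  let ?m = "min (H t (t - \<delta>)) (H t (t + \<delta>))"
  define w where "w c = width t (lo t c) (hi t c)" for c
  obtain b where b: "b > 0" "\<And>c. 0 < c \<Longrightarrow> c < b \<Longrightarrow> ratio t c = 1/2"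
    using ev by (auto simp: eventually_at_right_field)
  define m where "m = min b ?m"
  have m: "m > 0" using b graph_radius_ends_pos[OF gr] by (simp add: m_def)
  \<comment> \<open>the width \<open>w\<close> satisfies \<open>w' = w / (2 * c)\<close>\<close>
  have "((\<lambda>c. (w c)\<^sup>2 / c) has_real_derivative 0) (at c)" if c: "c \<in> {0<..<m}" for c
  proof -
    have c': "0 < c" "c < ?m" "c < b" using c by (auto simp: m_def)
    note ch = chord_lo_hi_near[OF t gr c'(1,2)]
    note chD = chordD[OF ch(1)]
    note d = lo_hi_deriv[OF t gr c'(1,2)]
    have wp: "w c > 0" unfolding w_def using chord_areas(1)[OF t gr ch c'(1)] .
    have "(w has_real_derivative slope_gap t (lo t c) (hi t c)) (at c)"
      unfolding w_def width_def slope_gap_def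
      using DERIV_diff[OF DERIV_chain2[OF xi_deriv[OF chD(4), of t] d(2)] DERIV_chain2[OF xi_deriv[OF chD(3), of t] d(1)]]
      by simp
    moreover have "slope_gap t (lo t c) (hi t c) = w c / (2 * c)"
      using b(2)[OF c'(1,3)] wp c' unfolding ratio_def w_def[symmetric] by (simp add: field_simps)
    ultimately have "(w has_real_derivative w c / (2 * c)) (at c)" by simp
    from DERIV_divide[OF DERIV_power[OF this, of 2] DERIV_ident] c'
    show ?thesis by (simp add: power2_eq_square)
  qed
  then have "\<exists>k. \<forall>c\<in>{0<..<m}. (w c)\<^sup>2 / c = k"
    by (intro has_field_derivative_zero_constant) (auto intro: has_field_derivative_at_within)
  then obtain k where k: "\<And>c. 0 < c \<Longrightarrow> c < m \<Longrightarrow> (w c)\<^sup>2 / c = k" by auto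
  have evm: "\<forall>\<^sub>F c in at_right 0. 0 < c \<and> c < m" using m by (auto simp: eventually_at_right_field)
  have "((\<lambda>c. (w c)\<^sup>2 / c) \<longlongrightarrow> 8 / D t) (at_right 0)" unfolding w_def by (rule chord_limits(2)[OF t])
  moreover have "\<forall>\<^sub>F c in at_right 0. (w c)\<^sup>2 / c = k" using evm by eventually_elim (auto intro: k)
  ultimately have "((\<lambda>c. k) \<longlongrightarrow> 8 / D t) (at_right (0::real))" by (simp add: tendsto_cong)
  then have "k = 8 / D t" using tendsto_unique[OF _ tendsto_const] by (metis trivial_limit_at_right_real)
  show ?thesis
    unfolding w_def[symmetric] using evm
  proof eventually_elim
    case (elim c)
    then have "c * ((w c)\<^sup>2 / c) = c * (8 / D t)" using k \<open>k = 8 / D t\<close> by auto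
    then show ?case using elim by simp
  qed
qed

end

section \<open>Comparison with conics\<close>

text \<open>A function with \<open>a'\<close> \<open>= r * b\<close> is nonnegative if \<open>a\<close> and \<open>b\<close> vanish at \<open>\<tau>\<close>, \<open>r\<close> is nonnegative and
  \<open>b\<close> is nondecreasing.\<close>

lemma nonneg_of_second_order:
  fixes a b :: "real \<Rightarrow> real"
  assumes a: "\<And>s. \<bar>s - \<tau>\<bar> < e \<Longrightarrow> (a has_real_derivative r s * b s) (at s)"
    and r: "\<And>s. \<bar>s - \<tau>\<bar> < e \<Longrightarrow> r s \<ge> 0"
    and b: "\<And>s. \<bar>s - \<tau>\<bar> < e \<Longrightarrow> (b has_real_derivative b' s) (at s)"
    and b': "\<And>s. \<bar>s - \<tau>\<bar> < e \<Longrightarrow> b' s \<ge> 0"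
    and 0: "a \<tau> = 0" "b \<tau> = 0" and s: "\<bar>s - \<tau>\<bar> < e"
  shows "a s \<ge> 0"
proof -
  have mb: "b u \<le> b v" if "u \<le> v" "\<bar>u - \<tau>\<bar> < e" "\<bar>v - \<tau>\<bar> < e" for u v
  proof (rule DERIV_nonneg_imp_nondecreasing[OF that(1)])
    fix z assume "u \<le> z" "z \<le> v"
    then have "\<bar>z - \<tau>\<bar> < e" using that by auto
    then show "\<exists>y. (b has_real_derivative y) (at z) \<and> 0 \<le> y" using b b' by blast
  qed
  show ?thesis
  proof (cases "\<tau> \<le> s")
    case True
    have "a \<tau> \<le> a s"
    proof (rule DERIV_nonneg_imp_nondecreasing[OF True])
      fix z assume z: "\<tau> \<le> z" "z \<le> s"
      then have ze: "\<bar>z - \<tau>\<bar> < e" using s by auto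
      have "0 \<le> r z * b z" using r[OF ze] mb[of \<tau> z] z ze 0 s by (intro mult_nonneg_nonneg) auto
      then show "\<exists>y. (a has_real_derivative y) (at z) \<and> 0 \<le> y" using a[OF ze] by blast
    qed
    then show ?thesis using 0 by simp
  next
    case False
    have "a s \<ge> a \<tau>"
    proof (rule DERIV_nonpos_imp_nonincreasing[where f = a and a = s and b = \<tau>])
      show "s \<le> \<tau>" using False by simp
      fix z assume z: "s \<le> z" "z \<le> \<tau>"
      then have ze: "\<bar>z - \<tau>\<bar> < e" using s by auto
      have "r z * b z \<le> 0" using r[OF ze] mb[of z \<tau>] z ze 0 s by (intro mult_nonneg_nonpos) auto
      then show "\<exists>y. (a has_real_derivative y) (at z) \<and> y \<le> 0" using a[OF ze] by blast
    qed
    then show ?thesis using 0 by simp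
  qed
qed

text \<open>An explicit solution of \<open>F''\<close> \<open>=\<close> \<open>Q\<close> to the power \<open>-3/2\<close> with \<open>F\<close> and \<open>F'\<close> zero at \<open>0\<close>, for a quadratic
  polynomial \<open>Q\<close> of nonzero discriminant. Its graph is an arc of a conic.\<close>

lemma conic_integral_derivatives:
  fixes \<alpha> b d z :: real
  defines "Q \<equiv> (\<lambda>z. \<alpha>\<^sup>2 + b * z + d * z\<^sup>2)"
  assumes al: "\<alpha> > 0" and Q: "Q z > 0" and nd: "b\<^sup>2 - 4 * \<alpha>\<^sup>2 * d \<noteq> 0"
  defines "\<mu> \<equiv> 4 / (b\<^sup>2 - 4 * \<alpha>\<^sup>2 * d)"
  shows "((\<lambda>z. \<mu> * (\<alpha> + b * z / (2 * \<alpha>) - sqrt (Q z))) has_real_derivative 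
           \<mu> * (b / (2 * \<alpha>) - (b + 2 * d * z) / (2 * sqrt (Q z)))) (at z)"
    and "((\<lambda>z. \<mu> * (b / (2 * \<alpha>) - (b + 2 * d * z) / (2 * sqrt (Q z)))) has_real_derivative 
           1 / (sqrt (Q z)) ^ 3) (at z)"
proof -
  let ?R = "sqrt (Q z)"
  have R: "?R > 0" "?R\<^sup>2 = Q z" using Q by auto
  have dQ: "(Q has_real_derivative b + 2 * d * z) (at z)"
    unfolding Q_def by (auto intro!: derivative_eq_intros)
  have dR: "((\<lambda>z. sqrt (Q z)) has_real_derivative (b + 2 * d * z) / (2 * ?R)) (at z)"
    using DERIV_chain2[where f = sqrt and g = Q and x = z, OF DERIV_real_sqrt[OF Q] dQ]
    by (simp add: field_simps)
  show "((\<lambda>z. \<mu> * (\<alpha> + b * z / (2 * \<alpha>) - sqrt (Q z))) has_real_derivative 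
           \<mu> * (b / (2 * \<alpha>) - (b + 2 * d * z) / (2 * sqrt (Q z)))) (at z)"
  proof -
    have "((\<lambda>z. \<alpha> + b * z / (2 * \<alpha>)) has_real_derivative b / (2 * \<alpha>)) (at z)"
      using DERIV_add[OF DERIV_const DERIV_cdivide[OF DERIV_cmult_Id]] by simp
    from DERIV_cmult[OF DERIV_diff[OF this dR]] show ?thesis .
  qed
  have "((\<lambda>z. (b + 2 * d * z) / (2 * sqrt (Q z))) has_real_derivative
      (2 * d * (2 * ?R) - (b + 2 * d * z) * (2 * ((b + 2 * d * z) / (2 * ?R)))) / ((2 * ?R) * (2 * ?R))) (at z)"
  proof (rule DERIV_divide)
    show "((\<lambda>z. b + 2 * d * z) has_real_derivative 2 * d) (at z)"
      by (rule derivative_eq_intros refl | simp)+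
  qed (use R DERIV_cmult[OF dR, of 2] in auto)
  moreover have "(2 * d * (2 * ?R) - (b + 2 * d * z) * (2 * ((b + 2 * d * z) / (2 * ?R)))) / ((2 * ?R) * (2 * ?R))
      = - ((b\<^sup>2 - 4 * \<alpha>\<^sup>2 * d) / (4 * ?R ^ 3))"
  proof -
    have "(2 * d * (2 * R) - (b + 2 * d * z) * (2 * ((b + 2 * d * z) / (2 * R)))) / ((2 * R) * (2 * R))
      = (4 * d * R\<^sup>2 - (b + 2 * d * z)\<^sup>2) / (4 * R ^ 3)" if "R > 0" for R
      using that by (simp add: field_simps power2_eq_square power3_eq_cube)
    note this[OF R(1)]
    also have "4 * d * ?R\<^sup>2 - (b + 2 * d * z)\<^sup>2 = - (b\<^sup>2 - 4 * \<alpha>\<^sup>2 * d)"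
      unfolding R(2) by (simp add: Q_def algebra_simps power2_eq_square)
    finally show ?thesis by (simp only: minus_divide_left)
  qed
  ultimately have "((\<lambda>z. (b + 2 * d * z) / (2 * sqrt (Q z))) has_real_derivative
      - ((b\<^sup>2 - 4 * \<alpha>\<^sup>2 * d) / (4 * ?R ^ 3))) (at z)" by simp
  note d = DERIV_cmult[OF DERIV_diff[OF DERIV_const this], of \<mu> "b / (2 * \<alpha>)"]
  show "((\<lambda>z. \<mu> * (b / (2 * \<alpha>) - (b + 2 * d * z) / (2 * sqrt (Q z)))) has_real_derivative 
           1 / (sqrt (Q z)) ^ 3) (at z)"
  proof (rule DERIV_cong[OF d])
    have "\<mu> * (0 - - (N / (4 * ?R ^ 3))) = 1 / ?R ^ 3" if "\<mu> = 4 / N" "N \<noteq> 0" for N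
      using that by simp
    from this[OF meta_eq_to_obj_eq[OF \<mu>_def] nd] show "\<mu> * (0 - - ((b\<^sup>2 - 4 * \<alpha>\<^sup>2 * d) / (4 * ?R ^ 3))) = 1 / ?R ^ 3" .
  qed
qed

text \<open>The functions \<open>x\<close>, \<open>\<eta>\<close> parametrize a curve through the origin with slope \<open>p\<close>, and
  \<open>(1 / \<gamma>) ^ 3\<close> is the second derivative of \<open>\<eta>\<close> with respect to \<open>x\<close>. If \<open>Q\<close> lies on one side of
  \<open>\<gamma>\<^sup>2\<close>, then the curve stays on one side of the conic belonging to \<open>Q\<close>. The conclusion is
  the quadratic equation of that conic, turned into an inequality; \<open>\<theta>\<close> selects the side.\<close>

lemma comparison_with_conic:
  fixes x x' \<eta> p \<gamma> :: "real \<Rightarrow> real" and \<alpha> b d :: real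
  defines "Q \<equiv> (\<lambda>z. \<alpha>\<^sup>2 + b * z + d * z\<^sup>2)"
  assumes e0: "e0 > 0"
    and x: "\<And>s. \<bar>s - \<tau>\<bar> < e0 \<Longrightarrow> (x has_real_derivative x' s) (at s)" "\<And>s. \<bar>s - \<tau>\<bar> < e0 \<Longrightarrow> x' s > 0"
    and \<eta>: "\<And>s. \<bar>s - \<tau>\<bar> < e0 \<Longrightarrow> (\<eta> has_real_derivative x' s * p s) (at s)"
    and p: "\<And>s. \<bar>s - \<tau>\<bar> < e0 \<Longrightarrow> (p has_real_derivative x' s * (1 / (\<gamma> s) ^ 3)) (at s)"
    and \<gamma>: "\<And>s. \<bar>s - \<tau>\<bar> < e0 \<Longrightarrow> \<gamma> s > 0"
    and 0: "x \<tau> = 0" "\<eta> \<tau> = 0" "p \<tau> = 0" 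
    and al: "\<alpha> > 0" and th: "\<theta> = 1 \<or> \<theta> = -1"
    and touch: "\<And>s. \<bar>s - \<tau>\<bar> < e0 \<Longrightarrow> \<theta> * (Q (x s) - (\<gamma> s)\<^sup>2) \<ge> 0"
    and nd: "b\<^sup>2 - 4 * \<alpha>\<^sup>2 * d \<noteq> 0"
  shows "\<exists>e>0. \<forall>s. \<bar>s - \<tau>\<bar> < e \<longrightarrow>
     \<theta> * ((x s)\<^sup>2 - \<alpha> * b * x s * \<eta> s - 2 * \<alpha> ^ 3 * \<eta> s + \<alpha>\<^sup>2 * (\<eta> s)\<^sup>2 * (b\<^sup>2 / 4 - \<alpha>\<^sup>2 * d)) \<le> 0"
proof -
  define \<mu> where "\<mu> = 4 / (b\<^sup>2 - 4 * \<alpha>\<^sup>2 * d)"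
  define w where "w z = \<alpha> + b * z / (2 * \<alpha>)" for z
  define F where "F z = \<mu> * (w z - sqrt (Q z))" for z
  define E where "E z = \<mu> * (b / (2 * \<alpha>) - (b + 2 * d * z) / (2 * sqrt (Q z)))" for z
  have mu: "\<mu> \<noteq> 0" "1 / \<mu> = (b\<^sup>2 - 4 * \<alpha>\<^sup>2 * d) / 4" using nd by (auto simp: \<mu>_def)
  have cx: "isCont x \<tau>" and c\<eta>: "isCont \<eta> \<tau>" using x(1)[of \<tau>] \<eta>[of \<tau>] e0 by (auto intro: DERIV_isCont)
  have "isCont (\<lambda>s. Q (x s)) \<tau>" "isCont (\<lambda>s. w (x s) - \<eta> s / \<mu>) \<tau>"
    unfolding Q_def w_def using al mu by (intro continuous_intros cx c\<eta>; simp)+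
  from this[THEN isCont_tendsto_compose, OF filterlim_ident]
  have lim: "((\<lambda>s. Q (x s)) \<longlongrightarrow> Q (x \<tau>)) (nhds \<tau>)"
      "((\<lambda>s. w (x s) - \<eta> s / \<mu>) \<longlongrightarrow> w (x \<tau>) - \<eta> \<tau> / \<mu>) (nhds \<tau>)"
    by blast+
  have "\<forall>\<^sub>F s in nhds \<tau>. 0 < Q (x s)" "\<forall>\<^sub>F s in nhds \<tau>. 0 < w (x s) - \<eta> s / \<mu>"
    by (rule order_tendstoD(1)[OF lim(1)], use al 0 in \<open>simp add: Q_def\<close>)
      (rule order_tendstoD(1)[OF lim(2)], use al 0 in \<open>simp add: w_def\<close>)
  then have "\<forall>\<^sub>F s in nhds \<tau>. 0 < Q (x s) \<and> 0 < w (x s) - \<eta> s / \<mu>" by eventually_elim simp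
  then obtain e1 where e1: "e1 > 0" "\<And>s. dist s \<tau> < e1 \<Longrightarrow> 0 < Q (x s) \<and> 0 < w (x s) - \<eta> s / \<mu>"
    unfolding eventually_nhds_metric by blast
  define e where "e = min e0 e1"
  have e: "e > 0" and near: "\<And>s. \<bar>s - \<tau>\<bar> < e \<Longrightarrow> \<bar>s - \<tau>\<bar> < e0"
    and Qp: "\<And>s. \<bar>s - \<tau>\<bar> < e \<Longrightarrow> 0 < Q (x s)" and zp: "\<And>s. \<bar>s - \<tau>\<bar> < e \<Longrightarrow> 0 < w (x s) - \<eta> s / \<mu>"
    using e0 e1 by (auto simp: e_def dist_real_def)
  have dF: "(F has_real_derivative E z) (at z)" and dE: "(E has_real_derivative 1 / (sqrt (Q z)) ^ 3) (at z)"
    if "0 < Q z" for z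
    using conic_integral_derivatives[OF al that[unfolded Q_def] nd]
    unfolding F_def[abs_def] E_def[abs_def] w_def[abs_def] Q_def \<mu>_def by blast+
  \<comment> \<open>the curve lies above the conic for \<open>\<theta> = 1\<close>, below it for \<open>\<theta> = -1\<close>\<close>
  have cmp: "0 \<le> \<theta> * (\<eta> s - F (x s))" if s: "\<bar>s - \<tau>\<bar> < e" for s
  proof (rule nonneg_of_second_order[where a = "\<lambda>s. \<theta> * (\<eta> s - F (x s))" and b = "\<lambda>s. \<theta> * (p s - E (x s))"
        and b' = "\<lambda>s. \<theta> * (x' s * (1 / (\<gamma> s) ^ 3) - 1 / (sqrt (Q (x s))) ^ 3 * x' s)"
        and r = x' and e = e and \<tau> = \<tau>, OF _ _ _ _ _ _ s])
    fix s assume s: "\<bar>s - \<tau>\<bar> < e"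
    note s0 = near[OF s] and Qs = Qp[OF s]
    have "((\<lambda>s. \<theta> * (\<eta> s - F (x s))) has_real_derivative \<theta> * (x' s * p s - E (x s) * x' s)) (at s)"
      by (rule DERIV_cmult[OF DERIV_diff[OF \<eta>[OF s0] DERIV_chain2[where f = F, OF dF[OF Qs] x(1)[OF s0]]]])
    then show "((\<lambda>s. \<theta> * (\<eta> s - F (x s))) has_real_derivative x' s * (\<theta> * (p s - E (x s)))) (at s)"
      by (simp add: algebra_simps)
    show "0 \<le> x' s" using x(2)[OF s0] by simp
    show "((\<lambda>s. \<theta> * (p s - E (x s))) has_real_derivative
        \<theta> * (x' s * (1 / (\<gamma> s) ^ 3) - 1 / (sqrt (Q (x s))) ^ 3 * x' s)) (at s)"
      by (rule DERIV_cmult[OF DERIV_diff[OF p[OF s0] DERIV_chain2[where f = E, OF dE[OF Qs] x(1)[OF s0]]]])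
    have R: "sqrt (Q (x s)) > 0" "(sqrt (Q (x s)))\<^sup>2 = Q (x s)" using Qs by auto
    have "0 \<le> \<theta> * (1 / (\<gamma> s) ^ 3 - 1 / (sqrt (Q (x s))) ^ 3)"
      using th
    proof
      assume t1: "\<theta> = 1"
      then have "(\<gamma> s)\<^sup>2 \<le> (sqrt (Q (x s)))\<^sup>2" using touch[OF s0] R by simp
      then have "\<gamma> s \<le> sqrt (Q (x s))" by (rule power2_le_imp_le) (use R in simp)
      then have "(\<gamma> s) ^ 3 \<le> (sqrt (Q (x s))) ^ 3" using \<gamma>[OF s0] by (intro power_mono) auto
      then show ?thesis using \<gamma>[OF s0] R t1 by (simp add: frac_le)
    next
      assume t1: "\<theta> = -1"
      then have "(sqrt (Q (x s)))\<^sup>2 \<le> (\<gamma> s)\<^sup>2" using touch[OF s0] R by simp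
      then have "sqrt (Q (x s)) \<le> \<gamma> s" by (rule power2_le_imp_le) (use \<gamma>[OF s0] in simp)
      then have "(sqrt (Q (x s))) ^ 3 \<le> (\<gamma> s) ^ 3" using R by (intro power_mono) auto
      then show ?thesis using \<gamma>[OF s0] R t1 by (simp add: frac_le)
    qed
    then have "0 \<le> x' s * (\<theta> * (1 / (\<gamma> s) ^ 3 - 1 / (sqrt (Q (x s))) ^ 3))"
      by (rule mult_nonneg_nonneg[OF less_imp_le[OF x(2)[OF s0]]])
    then show "0 \<le> \<theta> * (x' s * (1 / (\<gamma> s) ^ 3) - 1 / (sqrt (Q (x s))) ^ 3 * x' s)"
      by (simp add: algebra_simps)
  qed (use 0 al in \<open>simp_all add: F_def E_def w_def Q_def\<close>)
  have "\<theta> * ((x s)\<^sup>2 - \<alpha> * b * x s * \<eta> s - 2 * \<alpha> ^ 3 * \<eta> s + \<alpha>\<^sup>2 * (\<eta> s)\<^sup>2 * (b\<^sup>2 / 4 - \<alpha>\<^sup>2 * d)) \<le> 0"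
    if s: "\<bar>s - \<tau>\<bar> < e" for s
  proof -
    \<comment> \<open>squaring \<open>\<eta> = \<mu> * (w - R)\<close> removes the root; \<open>z\<close> is the value that \<open>R\<close> has on the conic\<close>
    define R z where "R = sqrt (Q (x s))" and "z = w (x s) - \<eta> s / \<mu>"
    have R: "R > 0" "R\<^sup>2 = Q (x s)" and z: "z > 0" using Qp[OF s] zp[OF s] by (auto simp: R_def z_def)
    have "\<eta> s - F (x s) = \<mu> * (R - z)" unfolding F_def R_def z_def using mu by (simp add: field_simps)
    then have "0 \<le> \<theta> * (\<mu> * (R - z))" using cmp[OF s] by simp
    then have "0 \<le> \<theta> * (\<mu> * (R - z)) * (R + z)" by (rule mult_nonneg_nonneg) (use R z in simp)
    also have "\<theta> * (\<mu> * (R - z)) * (R + z) = \<theta> * \<mu> * (R\<^sup>2 - z\<^sup>2)"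
      by (simp add: algebra_simps power2_eq_square)
    finally have nn: "0 \<le> \<alpha>\<^sup>2 * (\<theta> * \<mu> * (R\<^sup>2 - z\<^sup>2))" by (rule mult_nonneg_nonneg[OF zero_le_power2])
    have eq: "(x s)\<^sup>2 - \<alpha> * b * x s * \<eta> s - 2 * \<alpha> ^ 3 * \<eta> s + \<alpha>\<^sup>2 * (\<eta> s)\<^sup>2 * (b\<^sup>2 / 4 - \<alpha>\<^sup>2 * d)
        = \<alpha>\<^sup>2 * (\<mu> * (z\<^sup>2 - R\<^sup>2))"
    proof -
      have w2: "\<alpha>\<^sup>2 * ((w (x s))\<^sup>2 - Q (x s)) = (x s)\<^sup>2 * (1 / \<mu>)"
        unfolding mu(2) w_def Q_def using al by (simp add: field_simps power2_eq_square)
      then have w2': "\<mu> * (\<alpha>\<^sup>2 * ((w (x s))\<^sup>2 - Q (x s))) = (x s)\<^sup>2" using mu(1) by simp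
      have "\<alpha>\<^sup>2 * (\<mu> * (z\<^sup>2 - R\<^sup>2)) = \<mu> * (\<alpha>\<^sup>2 * ((w (x s))\<^sup>2 - Q (x s))) - 2 * (\<alpha>\<^sup>2 * w (x s)) * \<eta> s + \<alpha>\<^sup>2 * (\<eta> s)\<^sup>2 * (1 / \<mu>)"
        unfolding R(2) z_def using mu(1) by (simp add: field_simps power2_eq_square)
      also have "\<alpha>\<^sup>2 * w (x s) = \<alpha> ^ 3 + \<alpha> * b * x s / 2"
        unfolding w_def using al by (simp add: field_simps power2_eq_square power3_eq_cube)
      finally show ?thesis unfolding w2' mu(2) by (simp add: field_simps power2_eq_square)
    qed
    show ?thesis unfolding eq using nn by (simp add: algebra_simps)
  qed
  then show ?thesis using e by blast
qed

text \<open>At height \<open>k\<close> the squared chord of the conic is \<open>8 * \<alpha> ^ 3 * k + 4 * \<alpha> ^ 4 * d * k\<^sup>2\<close>. It is shorter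
  than that of a parabola with the same curvature if \<open>d < 0\<close>, the case of an ellipse, and longer if
  \<open>d > 0\<close>. With \<open>\<theta> = 1\<close> the points \<open>x1\<close>, \<open>x2\<close> lie inside the chord of the conic, with \<open>\<theta> = -1\<close> outside. The hypothesis
  \<open>k * b\<^sup>2 < 8 * \<alpha>\<close> ensures that \<open>0\<close> lies inside the chord of the conic when \<open>d > 0\<close>.\<close>

lemma conic_chord_too_short_or_long:
  fixes \<alpha> b d k x1 x2 \<theta> :: real
  assumes al: "\<alpha> > 0" and k: "k > 0" "k * b\<^sup>2 < 8 * \<alpha>" and x: "x1 < 0" "0 < x2"
    and th: "\<theta> = 1 \<or> \<theta> = -1" "\<theta> * d < 0"
    and C: "\<theta> * (x1\<^sup>2 - \<alpha> * b * x1 * k - 2 * \<alpha> ^ 3 * k + \<alpha>\<^sup>2 * k\<^sup>2 * (b\<^sup>2 / 4 - \<alpha>\<^sup>2 * d)) \<le> 0"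
      "\<theta> * (x2\<^sup>2 - \<alpha> * b * x2 * k - 2 * \<alpha> ^ 3 * k + \<alpha>\<^sup>2 * k\<^sup>2 * (b\<^sup>2 / 4 - \<alpha>\<^sup>2 * d)) \<le> 0"
  shows "(x2 - x1)\<^sup>2 \<noteq> 8 * \<alpha> ^ 3 * k"
proof -
  define m where "m = \<alpha> * k * b / 2"
  define \<rho> where "\<rho> = 2 * \<alpha> ^ 3 * k + \<alpha> ^ 4 * d * k\<^sup>2"
  have Cm: "x\<^sup>2 - \<alpha> * b * x * k - 2 * \<alpha> ^ 3 * k + \<alpha>\<^sup>2 * k\<^sup>2 * (b\<^sup>2 / 4 - \<alpha>\<^sup>2 * d) = (x - m)\<^sup>2 - \<rho>" for x
    unfolding m_def \<rho>_def by (simp add: field_simps power2_eq_square power3_eq_cube power4_eq_xxxx)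
  note C' = C[unfolded Cm]
  have ak: "\<alpha> ^ 4 * k\<^sup>2 > 0" using al k by simp
  from th(1) show ?thesis
  proof
    assume t: "\<theta> = 1"
    have "\<alpha> ^ 4 * k\<^sup>2 * d < 0" using ak th t by (simp add: mult_pos_neg)
    then have r: "4 * \<rho> < 8 * \<alpha> ^ 3 * k" unfolding \<rho>_def by (simp add: algebra_simps)
    have "0 \<le> ((x2 - m) + (x1 - m))\<^sup>2" by simp
    then have "(x2 - x1)\<^sup>2 \<le> 2 * (x2 - m)\<^sup>2 + 2 * (x1 - m)\<^sup>2"
      by (simp add: power2_eq_square algebra_simps)
    also have "\<dots> \<le> 4 * \<rho>" using C' t by simp
    finally show ?thesis using r by linarith
  next
    assume t: "\<theta> = -1"
    have "\<alpha> ^ 4 * k\<^sup>2 * d > 0" using ak th t by simp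
    then have r: "4 * \<rho> > 8 * \<alpha> ^ 3 * k" unfolding \<rho>_def by (simp add: algebra_simps)
    define q where "q = sqrt \<rho>"
    have "0 < \<alpha> ^ 3 * k" using al k by simp
    then have "\<rho> > 0" using r by linarith
    then have q: "q > 0" "q\<^sup>2 = \<rho>" by (auto simp: q_def)
    have "m\<^sup>2 = \<alpha>\<^sup>2 * k / 4 * (k * b\<^sup>2)" unfolding m_def by (simp add: field_simps power2_eq_square)
    also have "\<dots> < \<alpha>\<^sup>2 * k / 4 * (8 * \<alpha>)" using al k by (intro mult_strict_left_mono) auto
    also have "\<dots> = 2 * \<alpha> ^ 3 * k" by (simp add: power2_eq_square power3_eq_cube)
    also have "\<dots> < q\<^sup>2" using r q by linarith
    finally have m: "\<bar>m\<bar> < q" using q by (simp add: abs_less_iff power2_less_imp_less flip: abs_of_pos)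
    have "q\<^sup>2 \<le> (x1 - m)\<^sup>2" "q\<^sup>2 \<le> (x2 - m)\<^sup>2" using C' t q by auto
    then have "q \<le> \<bar>x1 - m\<bar>" "q \<le> \<bar>x2 - m\<bar>" using q by (auto simp: abs_le_square_iff[symmetric])
    then have "2 * q \<le> x2 - x1" using m x by linarith
    then have "(2 * q)\<^sup>2 \<le> (x2 - x1)\<^sup>2" using q by (intro power_mono) auto
    moreover have "(2 * q)\<^sup>2 = 4 * \<rho>" using q by (simp add: power_mult_distrib)
    ultimately show ?thesis using r by linarith
  qed
qed

text \<open>A maximum principle: if \<open>G\<close> is not an affine function of \<open>x\<close>, then some quadratic polynomial in
  \<open>x\<close>, concave and above \<open>G\<close> or convex and below \<open>G\<close>, touches \<open>G\<close> at an interior point. It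
  is found by adding a small multiple of \<open>(x - x t1) * (x - x t2)\<close> to the difference of \<open>G\<close> and
  its linear interpolation and taking an extremum.\<close>

lemma affine_if_never_touched:
  fixes G x :: "real \<Rightarrow> real"
  assumes tt: "t1 < t2" and cG: "continuous_on {t1..t2} G" and cx: "continuous_on {t1..t2} x" and xx: "x t1 < x t2"
    and no: "\<And>\<tau> b d \<theta>. \<lbrakk>t1 < \<tau>; \<tau> < t2; \<theta> = 1 \<or> \<theta> = -1; \<theta> * d < 0;
       \<And>s. s \<in> {t1..t2} \<Longrightarrow> 0 \<le> \<theta> * (G \<tau> + b * (x s - x \<tau>) + d * (x s - x \<tau>)\<^sup>2 - G s)\<rbrakk> \<Longrightarrow> False"
  shows "\<exists>A B. \<forall>s\<in>{t1..t2}. G s = A + B * x s"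
proof -
  define B where "B = (G t2 - G t1) / (x t2 - x t1)"
  define A where "A = G t1 - B * x t1"
  have l1: "G t1 = A + B * x t1" by (simp add: A_def)
  have "B * (x t2 - x t1) = G t2 - G t1" using xx by (simp add: B_def)
  then have l2: "G t2 = A + B * x t2" by (simp add: A_def algebra_simps)
  have "G u = A + B * x u" if u: "u \<in> {t1..t2}" for u
  proof (rule ccontr)
    assume ne: "G u \<noteq> A + B * x u"
    define \<theta> where "\<theta> = sgn (G u - (A + B * x u))"
    have th: "\<theta> = 1 \<or> \<theta> = -1" "0 < \<theta> * (G u - (A + B * x u))"
      using ne by (auto simp: \<theta>_def sgn_if)
    then have th2: "\<theta> * \<theta> = 1" by auto
    define P where "P s = (x s - x t1) * (x s - x t2)" for s
    define \<epsilon> where "\<epsilon> = \<theta> * (G u - (A + B * x u)) / (\<bar>P u\<bar> + 1)"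
    have ep: "\<epsilon> > 0" unfolding \<epsilon>_def using th(2) by (intro divide_pos_pos) auto
    define f where "f s = \<theta> * (G s - (A + B * x s)) + \<epsilon> * P s" for s
    have "\<epsilon> * (\<bar>P u\<bar> + 1) = \<theta> * (G u - (A + B * x u))" by (simp add: \<epsilon>_def add_nonneg_eq_0_iff)
    moreover have "\<epsilon> * (- \<bar>P u\<bar>) \<le> \<epsilon> * P u" using ep by (intro mult_left_mono) auto
    ultimately have fu: "f u > 0" unfolding f_def using ep by (simp add: algebra_simps)
    have "continuous_on {t1..t2} f" unfolding f_def P_def by (intro continuous_intros cG cx)
    then obtain \<tau> where \<tau>: "\<tau> \<in> {t1..t2}" "\<And>s. s \<in> {t1..t2} \<Longrightarrow> f s \<le> f \<tau>"
      using continuous_attains_sup[of "{t1..t2}" f] tt by auto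
    have "f t1 = 0" "f t2 = 0" by (auto simp: f_def P_def l1 l2)
    then have i: "t1 < \<tau>" "\<tau> < t2" using \<tau> fu u by (force simp: less_le)+
    show False
    proof (rule no[OF i th(1), of "- \<theta> * \<epsilon>" "B - \<theta> * \<epsilon> * (2 * x \<tau> - x t1 - x t2)"])
      show "\<theta> * (- \<theta> * \<epsilon>) < 0" using th2 ep by (simp add: mult.assoc[symmetric])
      fix s assume s: "s \<in> {t1..t2}"
      have "\<theta> * (G \<tau> + (B - \<theta> * \<epsilon> * (2 * x \<tau> - x t1 - x t2)) * (x s - x \<tau>) + - \<theta> * \<epsilon> * (x s - x \<tau>)\<^sup>2 - G s)
         = \<theta> * (G \<tau> + B * (x s - x \<tau>) - G s) - \<theta> * \<theta> * (\<epsilon> * ((2 * x \<tau> - x t1 - x t2) * (x s - x \<tau>) + (x s - x \<tau>)\<^sup>2))"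
        by (simp add: algebra_simps)
      also have "\<dots> = f \<tau> - f s"
        unfolding th2 f_def P_def by (simp add: algebra_simps power2_eq_square)
      finally show "0 \<le> \<theta> * (G \<tau> + (B - \<theta> * \<epsilon> * (2 * x \<tau> - x t1 - x t2)) * (x s - x \<tau>) + - \<theta> * \<epsilon> * (x s - x \<tau>)\<^sup>2 - G s)"
        using \<tau>(2)[OF s] by simp
    qed
  qed
  then show ?thesis by blast
qed

section \<open>Constancy of the affine normal\<close>

context convex_arc
begin

text \<open>The speed with respect to affine arclength.\<close>

definition affine_speed where "affine_speed t = root 3 (D t)"

lemma affine_speed_pos: "t \<in> I \<Longrightarrow> affine_speed t > 0"
  unfolding affine_speed_def using D_pos by simp

lemma affine_speed_cube: "affine_speed t ^ 3 = D t"
  unfolding affine_speed_def by (simp add: odd_real_root_pow)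

lemma D_deriv: "t \<in> I \<Longrightarrow> (D has_real_derivative \<epsilon> * cross2 (V t) (Z t)) (at t)"
proof -
  assume t: "t \<in> I"
  have "((\<lambda>t. cross2 (V t) (W t)) has_vector_derivative cross2 (V t) (Z t) + cross2 (W t) (W t)) (at t)"
    by (rule cross2_derivative[OF V_deriv[OF t] W_deriv[OF t]])
  then have "((\<lambda>t. cross2 (V t) (W t)) has_real_derivative cross2 (V t) (Z t)) (at t)"
    by (simp add: has_real_derivative_iff_has_vector_derivative)
  then show ?thesis unfolding D_def[abs_def] by (rule DERIV_cmult)
qed

definition affine_speed' where "affine_speed' t = inverse (3 * affine_speed t ^ 2) * (\<epsilon> * cross2 (V t) (Z t))"

lemma affine_speed_deriv: "t \<in> I \<Longrightarrow> (affine_speed has_real_derivative affine_speed' t) (at t)"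
proof -
  assume t: "t \<in> I"
  have "(root 3 has_real_derivative inverse (real 3 * root 3 (D t) ^ (3 - Suc 0))) (at (D t))"
    using D_pos[OF t] by (intro DERIV_odd_real_root) auto
  from DERIV_chain2[where f = "root 3" and g = D and x = t, OF this D_deriv[OF t]]
  show ?thesis unfolding affine_speed_def[abs_def] affine_speed'_def by simp
qed

text \<open>The first two derivatives of the curve with respect to affine arclength. The second one is the
  affine normal; it is constant exactly on arcs of parabolas.\<close>

definition affine_velocity where "affine_velocity t = (1 / affine_speed t) *\<^sub>R V t"
definition affine_velocity' where
  "affine_velocity' t = (1 / affine_speed t) *\<^sub>R W t + (- affine_speed' t / (affine_speed t)\<^sup>2) *\<^sub>R V t"
definition affine_normal where "affine_normal t = (1 / affine_speed t) *\<^sub>R affine_velocity' t"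

lemma affine_velocity_deriv:
  assumes t: "t \<in> I"
  shows "(affine_velocity has_vector_derivative affine_velocity' t) (at t)"
proof -
  have "((\<lambda>t. 1 / affine_speed t) has_real_derivative - affine_speed' t / (affine_speed t)\<^sup>2) (at t)"
    using DERIV_inverse_fun[OF affine_speed_deriv[OF t]] affine_speed_pos[OF t]
    by (simp add: inverse_eq_divide power2_eq_square)
  from has_vector_derivative_scaleR[OF this V_deriv[OF t]]
  show ?thesis unfolding affine_velocity_def[abs_def] affine_velocity'_def .
qed

lemma cross2_affine_velocity:
  assumes t: "t \<in> I"
  shows "cross2 (affine_velocity t) (affine_normal t) = \<epsilon>"
proof -
  have c: "cross2 (V t) (W t) = \<epsilon> * affine_speed t ^ 3" using eps by (auto simp: affine_speed_cube D_def)
  have "cross2 (affine_velocity t) (affine_normal t) = cross2 (V t) (W t) / affine_speed t ^ 3"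
    unfolding affine_velocity_def affine_normal_def affine_velocity'_def
    by (simp add: cross2_add power3_eq_cube)
  then show ?thesis using c affine_speed_pos[OF t] by simp
qed

text \<open>All sufficiently small chords have the width that they would have on a parabola with the same
  curvature.\<close>

definition parabolic_chords where
  "parabolic_chords \<longleftrightarrow> (\<forall>t\<in>I. \<forall>\<^sub>F c in at_right 0. (width t (lo t c) (hi t c))\<^sup>2 = 8 * c / D t)"

text \<open>In the frame with abscissa \<open>e \<bullet> X\<close>, the square of \<open>e \<bullet> affine_velocity\<close> is the second
  derivative of the graph to the power \<open>-2/3\<close>. By comparison with the conic of the touching polynomial, the
  chord at the point of contact would be too short or too long.\<close>

lemma not_touched_by_conic:
  assumes pc: "parabolic_chords" and \<tau>: "t1 < \<tau>" "\<tau> < t2" and I: "{t1..t2} \<subseteq> I"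
    and ep: "\<And>s. s \<in> {t1..t2} \<Longrightarrow> e \<bullet> V s > 0"
    and th: "\<theta> = 1 \<or> \<theta> = -1" "\<theta> * d0 < 0"
    and touch0: "\<And>s. s \<in> {t1..t2} \<Longrightarrow> 0 \<le> \<theta> * ((e \<bullet> affine_velocity \<tau>)\<^sup>2 + b * (e \<bullet> X s - e \<bullet> X \<tau>)
       + d0 * (e \<bullet> X s - e \<bullet> X \<tau>)\<^sup>2 - (e \<bullet> affine_velocity s)\<^sup>2)"
  shows False
proof -
  define \<gamma> where "\<gamma> s = e \<bullet> affine_velocity s" for s
  define \<alpha> where "\<alpha> = \<gamma> \<tau>"
  define v where "v = e \<bullet> V \<tau>"
  have \<tau>I: "\<tau> \<in> I" using \<tau> I by auto
  have v: "v > 0" unfolding v_def using ep \<tau> by simp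
  have \<gamma>: "\<gamma> s > 0" "affine_speed s * \<gamma> s = e \<bullet> V s" if "s \<in> {t1..t2}" for s
    using ep[OF that] affine_speed_pos[of s] that I by (auto simp: \<gamma>_def affine_velocity_def)
  have al: "\<alpha> > 0" unfolding \<alpha>_def using \<gamma> \<tau> by simp
  obtain d where d: "\<theta> * d < 0" "b\<^sup>2 - 4 * \<alpha>\<^sup>2 * d \<noteq> 0"
    and touch: "\<And>s. s \<in> {t1..t2} \<Longrightarrow> 0 \<le> \<theta> * (\<alpha>\<^sup>2 + b * (e \<bullet> (X s - X \<tau>)) + d * (e \<bullet> (X s - X \<tau>))\<^sup>2 - (\<gamma> s)\<^sup>2)"
  proof (cases "b\<^sup>2 - 4 * \<alpha>\<^sup>2 * d0 = 0")
    case False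
    show ?thesis
      by (rule that[OF th(2) False]) (use touch0 in \<open>simp add: inner_diff_right \<alpha>_def \<gamma>_def\<close>)
  next
    case True
    \<comment> \<open>halving the leading coefficient keeps the inequality and makes the discriminant nonzero\<close>
    have "d0 \<noteq> 0" using th by auto
    then have "4 * \<alpha>\<^sup>2 * (d0 / 2) \<noteq> 4 * \<alpha>\<^sup>2 * d0" using al by simp
    then have nd: "b\<^sup>2 - 4 * \<alpha>\<^sup>2 * (d0 / 2) \<noteq> 0" using True by simp
    show ?thesis
    proof (rule that[OF _ nd])
      show "\<theta> * (d0 / 2) < 0" using th by simp
      fix s assume s: "s \<in> {t1..t2}"
      have "\<theta> * d0 * (e \<bullet> (X s - X \<tau>))\<^sup>2 \<le> 0" using th by (simp add: mult_nonpos_nonneg)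
      with touch0[OF s]
      show "0 \<le> \<theta> * (\<alpha>\<^sup>2 + b * (e \<bullet> (X s - X \<tau>)) + d0 / 2 * (e \<bullet> (X s - X \<tau>))\<^sup>2 - (\<gamma> s)\<^sup>2)"
        by (simp add: inner_diff_right \<alpha>_def \<gamma>_def algebra_simps)
    qed
  qed
  define e0 where "e0 = min (\<tau> - t1) (t2 - \<tau>)"
  have e0: "e0 > 0" using \<tau> by (simp add: e0_def)
  have near: "s \<in> {t1..t2}" "s \<in> I" if "\<bar>s - \<tau>\<bar> < e0" for s
  proof -
    show "s \<in> {t1..t2}" using that by (auto simp: e0_def abs_less_iff)
    then show "s \<in> I" using I by blast
  qed
  define x where "x s = e \<bullet> (X s - X \<tau>)" for s
  define \<eta> where "\<eta> s = H \<tau> s / v" for s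
  define p where "p s = H' \<tau> s / v / (e \<bullet> V s)" for s
  have dx: "(x has_real_derivative e \<bullet> V s) (at s)" if "s \<in> I" for s
    unfolding x_def[abs_def] by (rule cross2_inner_has_real_derivative(2)[OF X_diff_deriv[OF that]])
  have "\<exists>ee>0. \<forall>s. \<bar>s - \<tau>\<bar> < ee \<longrightarrow>
     \<theta> * ((x s)\<^sup>2 - \<alpha> * b * x s * \<eta> s - 2 * \<alpha> ^ 3 * \<eta> s + \<alpha>\<^sup>2 * (\<eta> s)\<^sup>2 * (b\<^sup>2 / 4 - \<alpha>\<^sup>2 * d)) \<le> 0"
  proof (rule comparison_with_conic[where x' = "\<lambda>s. e \<bullet> V s" and p = p and \<gamma> = \<gamma>, OF e0])
    fix s assume s: "\<bar>s - \<tau>\<bar> < e0"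
    note sI = near[OF s]
    have V0: "e \<bullet> V s > 0" using ep sI by blast
    show "(x has_real_derivative e \<bullet> V s) (at s)" by (rule dx[OF sI(2)])
    show "0 < e \<bullet> V s" "\<gamma> s > 0" using V0 \<gamma> sI by auto
    show "(\<eta> has_real_derivative (e \<bullet> V s) * p s) (at s)"
      using DERIV_cdivide[OF H_deriv[OF sI(2)], of \<tau> v] V0 by (simp add: \<eta>_def[abs_def] p_def)
    have "(p has_real_derivative (\<epsilon> * cross2 (V \<tau>) (W s) / v * (e \<bullet> V s) - H' \<tau> s / v * (e \<bullet> W s)) /
       ((e \<bullet> V s) * (e \<bullet> V s))) (at s)"
      unfolding p_def[abs_def]
      by (intro DERIV_divide DERIV_cdivide H'_deriv sI cross2_inner_has_real_derivative V_deriv) (use V0 in auto)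
    moreover have "(\<epsilon> * cross2 (V \<tau>) (W s) / v * (e \<bullet> V s) - H' \<tau> s / v * (e \<bullet> W s)) / ((e \<bullet> V s) * (e \<bullet> V s))
       = (e \<bullet> V s) * (1 / \<gamma> s ^ 3)"
    proof -
      have "cross2 (V \<tau>) (W s) * (e \<bullet> V s) - cross2 (V \<tau>) (V s) * (e \<bullet> W s) = v * cross2 (V s) (W s)"
        unfolding v_def plane_simps by (simp add: algebra_simps)
      then have "\<epsilon> * (cross2 (V \<tau>) (W s) * (e \<bullet> V s) - cross2 (V \<tau>) (V s) * (e \<bullet> W s)) = \<epsilon> * (v * cross2 (V s) (W s))"
        by simp
      then have "\<epsilon> * cross2 (V \<tau>) (W s) * (e \<bullet> V s) - H' \<tau> s * (e \<bullet> W s) = v * D s"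
        unfolding H'_def D_def by (simp add: right_diff_distrib mult_ac)
      then have "\<epsilon> * cross2 (V \<tau>) (W s) / v * (e \<bullet> V s) - H' \<tau> s / v * (e \<bullet> W s) = D s"
        using v by (simp add: field_simps)
      then show ?thesis using V0 \<gamma>[OF sI(1)] affine_speed_cube[of s, symmetric] affine_speed_pos[OF sI(2)]
        by (simp add: power3_eq_cube field_simps flip: \<gamma>(2)[OF sI(1)])
    qed
    ultimately show "(p has_real_derivative (e \<bullet> V s) * (1 / \<gamma> s ^ 3)) (at s)" by simp
    show "0 \<le> \<theta> * (\<alpha>\<^sup>2 + b * x s + d * (x s)\<^sup>2 - (\<gamma> s)\<^sup>2)" using touch[OF sI(1)] by (simp add: x_def)
  qed (use al th d in \<open>simp_all add: x_def \<eta>_def p_def\<close>)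
  then obtain e1 where e1: "e1 > 0" "\<And>s. \<bar>s - \<tau>\<bar> < e1 \<Longrightarrow>
     \<theta> * ((x s)\<^sup>2 - \<alpha> * b * x s * \<eta> s - 2 * \<alpha> ^ 3 * \<eta> s + \<alpha>\<^sup>2 * (\<eta> s)\<^sup>2 * (b\<^sup>2 / 4 - \<alpha>\<^sup>2 * d)) \<le> 0"
    by blast
  obtain \<delta>0 where gr0: "graph_radius \<tau> \<delta>0" using ex_graph_radius[OF \<tau>I] .
  define \<delta> where "\<delta> = min \<delta>0 (min e0 e1)"
  have gr: "graph_radius \<tau> \<delta>"
    by (rule graph_radius_smaller[OF gr0]) (use gr0 e0 e1 in \<open>auto simp: \<delta>_def graph_radius_def\<close>)
  have bp: "0 < 8 * \<alpha> * v / (b\<^sup>2 + 1)"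
    using al v by (intro divide_pos_pos mult_pos_pos add_nonneg_pos) auto
  have ev1: "\<forall>\<^sub>F c in at_right 0. (width \<tau> (lo \<tau> c) (hi \<tau> c))\<^sup>2 = 8 * c / D \<tau>"
    using pc \<tau>I by (simp add: parabolic_chords_def)
  have ev2: "\<forall>\<^sub>F c in at_right 0. c < 8 * \<alpha> * v / (b\<^sup>2 + 1)"
    using bp by (auto simp: eventually_at_right_field)
  have "\<forall>\<^sub>F c in at_right 0. (width \<tau> (lo \<tau> c) (hi \<tau> c))\<^sup>2 = 8 * c / D \<tau> \<and> c < 8 * \<alpha> * v / (b\<^sup>2 + 1) \<and>
      0 < c \<and> chord \<tau> c (lo \<tau> c) (hi \<tau> c) \<and> \<tau> - \<delta> < lo \<tau> c \<and> hi \<tau> c < \<tau> + \<delta>"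
    using eventually_chord[OF \<tau>I gr] ev1 ev2 by eventually_elim simp
  then obtain c where c: "(width \<tau> (lo \<tau> c) (hi \<tau> c))\<^sup>2 = 8 * c / D \<tau>" "c < 8 * \<alpha> * v / (b\<^sup>2 + 1)" "0 < c"
      "chord \<tau> c (lo \<tau> c) (hi \<tau> c)" "\<tau> - \<delta> < lo \<tau> c" "hi \<tau> c < \<tau> + \<delta>"
    using eventually_happens'[of "at_right (0::real)"] by auto
  define s1 s2 where "s1 = lo \<tau> c" and "s2 = hi \<tau> c"
  note ch = chordD[OF c(4), folded s1_def s2_def]
  have n1: "\<bar>s1 - \<tau>\<bar> < e0" "\<bar>s1 - \<tau>\<bar> < e1" and n2: "\<bar>s2 - \<tau>\<bar> < e0" "\<bar>s2 - \<tau>\<bar> < e1"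
    using c(5,6) ch by (auto simp: s1_def s2_def \<delta>_def)
  define k where "k = c / v"
  have k: "k > 0" unfolding k_def using c v by simp
  have "c * (b\<^sup>2 + 1) < 8 * \<alpha> * v" using c(2) by (simp add: pos_less_divide_eq add_nonneg_pos)
  then have "c * b\<^sup>2 < 8 * \<alpha> * v" using c(3) by (simp add: algebra_simps)
  then have kb: "k * b\<^sup>2 < 8 * \<alpha>" unfolding k_def using v by (simp add: pos_divide_less_eq)
  have e12: "\<eta> s1 = k" "\<eta> s2 = k" by (simp_all add: \<eta>_def k_def ch)
  have mono: "x u < x z" if "u < z" "\<bar>u - \<tau>\<bar> < e0" "\<bar>z - \<tau>\<bar> < e0" for u z
  proof (rule DERIV_pos_imp_increasing[where f = x, OF that(1)])
    fix y assume "u \<le> y" "y \<le> z"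
    then have "\<bar>y - \<tau>\<bar> < e0" using that by auto
    then show "\<exists>l. (x has_real_derivative l) (at y) \<and> 0 < l" using dx ep near by blast
  qed
  have x12: "x s1 < 0" "0 < x s2"
    using mono[of s1 \<tau>] mono[of \<tau> s2] ch n1 n2 e0 by (auto simp: x_def)
  have "X s2 - X s1 = width \<tau> s1 s2 *\<^sub>R V \<tau>"
    using frame_X[OF \<tau>I, of s1] frame_X[OF \<tau>I, of s2] ch by (simp add: width_def algebra_simps)
  then have "e \<bullet> (X s2 - X s1) = width \<tau> s1 s2 * v" by (simp add: v_def)
  then have "(x s2 - x s1)\<^sup>2 = (width \<tau> s1 s2)\<^sup>2 * v\<^sup>2" by (simp add: x_def inner_diff_right power_mult_distrib)
  also have "\<dots> = 8 * c / D \<tau> * v\<^sup>2" using c(1) by (simp add: s1_def s2_def)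
  also have "\<dots> = 8 * \<alpha> ^ 3 * k"
  proof -
    have "v = affine_speed \<tau> * \<alpha>" unfolding v_def \<alpha>_def using \<gamma>(2)[of \<tau>] \<tau> by simp
    then show ?thesis unfolding k_def affine_speed_cube[symmetric] using affine_speed_pos[OF \<tau>I] al
      by (simp add: field_simps power2_eq_square power3_eq_cube)
  qed
  finally have "(x s2 - x s1)\<^sup>2 = 8 * \<alpha> ^ 3 * k" .
  moreover have "(x s2 - x s1)\<^sup>2 \<noteq> 8 * \<alpha> ^ 3 * k"
    using conic_chord_too_short_or_long[OF al k kb x12 th(1) d(1)] e1(2)[OF n1(2)] e1(2)[OF n2(2)]
    unfolding e12 by blast
  ultimately show False by blast
qed

text \<open>If \<open>(e \<bullet> affine_velocity)\<^sup>2 = A + B * (e \<bullet> X)\<close>, then differentiation gives the value \<open>B / 2\<close> for the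
  component of the affine normal in direction \<open>e\<close>.\<close>

lemma affine_normal_component_const:
  assumes pc: "parabolic_chords" and t0: "t0 \<in> I" and e: "e \<bullet> V t0 > 0"
  obtains t1 t2 where "t1 < t0" "t0 < t2" "{t1<..<t2} \<subseteq> I"
    "\<And>s. s \<in> {t1<..<t2} \<Longrightarrow> e \<bullet> affine_normal s = e \<bullet> affine_normal t0"
proof -
  have "isCont (\<lambda>s. e \<bullet> V s) t0"
    by (rule DERIV_isCont[OF cross2_inner_has_real_derivative(2)[OF V_deriv[OF t0]]])
  from isCont_tendsto_compose[OF this filterlim_ident]
  have "\<forall>\<^sub>F s in nhds t0. 0 < e \<bullet> V s" by (rule order_tendstoD(1)) (rule e)
  moreover have "\<forall>\<^sub>F s in nhds t0. s \<in> I" using open_I t0 eventually_nhds_in_open by blast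
  ultimately have "\<forall>\<^sub>F s in nhds t0. 0 < e \<bullet> V s \<and> s \<in> I" by eventually_elim simp
  then obtain r where r: "r > 0" "\<And>s. dist s t0 < r \<Longrightarrow> 0 < e \<bullet> V s \<and> s \<in> I"
    unfolding eventually_nhds_metric by blast
  define t1 t2 where "t1 = t0 - r / 2" and "t2 = t0 + r / 2"
  have t12: "t1 < t0" "t0 < t2" using r by (auto simp: t1_def t2_def)
  have sI: "0 < e \<bullet> V s" "s \<in> I" if "s \<in> {t1..t2}" for s
    using r(1) r(2)[of s] that by (auto simp: t1_def t2_def dist_real_def abs_if)
  then have sub: "{t1..t2} \<subseteq> I" by blast
  have dY: "((\<lambda>s. e \<bullet> affine_velocity s) has_real_derivative e \<bullet> affine_velocity' s) (at s)" if "s \<in> I" for s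
    by (rule cross2_inner_has_real_derivative(2)[OF affine_velocity_deriv[OF that]])
  have dX: "((\<lambda>s. e \<bullet> X s) has_real_derivative e \<bullet> V s) (at s)" if "s \<in> I" for s
    by (rule cross2_inner_has_real_derivative(2)[OF X_deriv[OF that]])
  have "\<exists>A B. \<forall>s\<in>{t1..t2}. (e \<bullet> affine_velocity s)\<^sup>2 = A + B * (e \<bullet> X s)"
  proof (rule affine_if_never_touched[where G = "\<lambda>s. (e \<bullet> affine_velocity s)\<^sup>2" and x = "\<lambda>s. e \<bullet> X s"])
    show "t1 < t2" using t12 by simp
    show "continuous_on {t1..t2} (\<lambda>s. (e \<bullet> affine_velocity s)\<^sup>2)"
      by (intro continuous_on_power continuous_at_imp_continuous_on ballI DERIV_isCont[OF dY] sI)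
    show "continuous_on {t1..t2} (\<lambda>s. e \<bullet> X s)"
      by (intro continuous_at_imp_continuous_on ballI DERIV_isCont[OF dX] sI)
    show "e \<bullet> X t1 < e \<bullet> X t2"
    proof (rule DERIV_pos_imp_increasing[where f = "\<lambda>s. e \<bullet> X s", OF \<open>t1 < t2\<close>])
      fix s assume "t1 \<le> s" "s \<le> t2"
      then have "s \<in> {t1..t2}" by simp
      from dX[OF sI(2)[OF this]] sI(1)[OF this]
      show "\<exists>y. ((\<lambda>s. e \<bullet> X s) has_real_derivative y) (at s) \<and> 0 < y" by blast
    qed
  qed (rule not_touched_by_conic[OF pc _ _ sub sI(1)])
  then obtain A B where AB: "\<And>s. s \<in> {t1..t2} \<Longrightarrow> (e \<bullet> affine_velocity s)\<^sup>2 = A + B * (e \<bullet> X s)"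
    by blast
  have c: "e \<bullet> affine_normal s = B / 2" if s: "s \<in> {t1<..<t2}" for s
  proof -
    have s': "s \<in> {t1..t2}" using s by auto
    note sI' = sI[OF s']
    define g where "g = e \<bullet> affine_velocity s"
    have wp: "affine_speed s > 0" using affine_speed_pos sI' by blast
    have gw: "e \<bullet> V s = g * affine_speed s" using wp by (simp add: g_def affine_velocity_def)
    then have g: "g > 0" using sI' wp by (simp add: zero_less_mult_iff)
    have "((\<lambda>s. A + B * (e \<bullet> X s)) has_real_derivative 0 + B * (e \<bullet> V s)) (at s)"
      by (intro DERIV_add DERIV_const DERIV_cmult dX[OF sI'(2)])
    then have "((\<lambda>s. (e \<bullet> affine_velocity s)\<^sup>2) has_real_derivative 0 + B * (e \<bullet> V s)) (at s)"
      by (rule has_field_derivative_transform_within_open[where S = "{t1<..<t2}"]) (use s AB in auto)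
    moreover have "((\<lambda>s. (e \<bullet> affine_velocity s)\<^sup>2) has_real_derivative 2 * g * (e \<bullet> affine_velocity' s)) (at s)"
      using DERIV_power[OF dY[OF sI'(2)], of 2] by (simp add: g_def mult_ac)
    ultimately have "0 + B * (e \<bullet> V s) = 2 * g * (e \<bullet> affine_velocity' s)" by (rule DERIV_unique)
    then have "e \<bullet> affine_velocity' s = B * affine_speed s / 2" using g unfolding gw by simp
    then show ?thesis using wp by (simp add: affine_normal_def)
  qed
  show thesis
  proof (rule that[OF t12])
    show "{t1<..<t2} \<subseteq> I" using sub by auto
    show "e \<bullet> affine_normal s = e \<bullet> affine_normal t0" if "s \<in> {t1<..<t2}" for s
      using c[OF that] c[of t0] t12 by simp
  qed
qed

lemma affine_normal_constant:
  assumes pc: "parabolic_chords"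
  shows "affine_normal constant_on I"
proof (rule locally_constant_imp_constant)
  show "connected I" using interval_I by (rule is_interval_connected)
  fix t0 assume t0: "t0 \<in> I"
  define v where "v = V t0"
  have v: "v \<noteq> 0" "v \<bullet> v > 0" using V_nz[OF t0] by (auto simp: v_def)
  \<comment> \<open>the components in two independent directions determine the affine normal\<close>
  have "v \<bullet> V t0 > 0" "(v + rot v) \<bullet> V t0 > 0"
    using v by (auto simp: v_def inner_add_left rot_inner)
  then obtain a1 a2 b1 b2 where
    a: "a1 < t0" "t0 < a2" "{a1<..<a2} \<subseteq> I" "\<And>s. s \<in> {a1<..<a2} \<Longrightarrow> v \<bullet> affine_normal s = v \<bullet> affine_normal t0" and
    b: "b1 < t0" "t0 < b2" "{b1<..<b2} \<subseteq> I" "\<And>s. s \<in> {b1<..<b2} \<Longrightarrow> (v + rot v) \<bullet> affine_normal s = (v + rot v) \<bullet> affine_normal t0"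
    using affine_normal_component_const[OF pc t0] by metis
  let ?T = "{a1<..<a2} \<inter> {b1<..<b2}"
  have "affine_normal s = affine_normal t0" if "s \<in> ?T" for s
  proof -
    have "v \<bullet> affine_normal s = v \<bullet> affine_normal t0" "cross2 v (affine_normal s) = cross2 v (affine_normal t0)"
      using a(4)[of s] b(4)[of s] that by (auto simp: inner_add_left rot_inner)
    then show ?thesis using frame_expand[OF v(1), of "affine_normal s"] frame_expand[OF v(1), of "affine_normal t0"]
      by simp
  qed
  moreover have "openin (top_of_set I) ?T" using a(3) by (intro open_subset) auto
  moreover have "t0 \<in> ?T" using a b by auto
  ultimately show "\<exists>T. openin (top_of_set I) T \<and> t0 \<in> T \<and> (\<forall>s\<in>T. affine_normal s = affine_normal t0)" by blast
qed

lemma quadratic_parametrization: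
  assumes pc: "parabolic_chords"
  obtains A B C J where "cross2 B C \<noteq> 0" "open J" "connected J" "J \<noteq> {}"
    "X ` I = (\<lambda>u. A + u *\<^sub>R B + (u\<^sup>2 / 2) *\<^sub>R C) ` J"
proof -
  obtain t0 where t0: "t0 \<in> I" using nonempty_I by blast
  obtain C where C: "\<And>t. t \<in> I \<Longrightarrow> affine_normal t = C"
    using affine_normal_constant[OF pc] by (auto simp: constant_on_def)
  define B where "B = affine_velocity t0"
  have BC: "cross2 B C \<noteq> 0" using cross2_affine_velocity[OF t0] C[OF t0] by (simp add: B_def)
  then have C0: "C \<bullet> C \<noteq> 0" by auto
  have conv: "convex I" using interval_I by (rule is_interval_convex)
  \<comment> \<open>the affine arclength; since \<open>affine_velocity\<close> grows by \<open>C\<close> per unit of it, no integration is needed\<close>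
  define \<sigma> where "\<sigma> t = C \<bullet> (affine_velocity t - B) / (C \<bullet> C)" for t
  have Y': "(affine_velocity has_vector_derivative affine_speed t *\<^sub>R C) (at t)" if "t \<in> I" for t
  proof -
    have "affine_velocity' t = affine_speed t *\<^sub>R C"
      using C[OF that] affine_speed_pos[OF that] by (auto simp: affine_normal_def)
    then show ?thesis using affine_velocity_deriv[OF that] by simp
  qed
  have d\<sigma>: "(\<sigma> has_real_derivative affine_speed t) (at t)" if "t \<in> I" for t
  proof -
    have "((\<lambda>t. affine_velocity t - B) has_vector_derivative affine_speed t *\<^sub>R C) (at t)"
      using has_vector_derivative_diff[OF Y'[OF that] has_vector_derivative_const] by simp
    from DERIV_cdivide[OF cross2_inner_has_real_derivative(2)[OF this], of C "C \<bullet> C"]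
    show ?thesis using C0 by (simp add: \<sigma>_def[abs_def])
  qed
  have dv\<sigma>: "(\<sigma> has_vector_derivative affine_speed t) (at t)" if "t \<in> I" for t
    using d\<sigma>[OF that] by (simp add: has_real_derivative_iff_has_vector_derivative)
  have Y: "affine_velocity t = B + \<sigma> t *\<^sub>R C" if t: "t \<in> I" for t
  proof -
    have "((\<lambda>t. affine_velocity t - \<sigma> t *\<^sub>R C) has_vector_derivative 0) (at s within I)" if s: "s \<in> I" for s
      using has_vector_derivative_diff[OF Y'[OF s] has_vector_derivative_scaleR[OF d\<sigma>[OF s] has_vector_derivative_const[of C]]]
      by (simp add: has_vector_derivative_at_within)
    then obtain K where "\<And>s. s \<in> I \<Longrightarrow> affine_velocity s - \<sigma> s *\<^sub>R C = K"
      using has_vector_derivative_zero_constant[OF conv] by blast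
    from this[OF t] this[OF t0] show ?thesis by (simp add: B_def \<sigma>_def algebra_simps)
  qed
  have VY: "V t = affine_speed t *\<^sub>R (B + \<sigma> t *\<^sub>R C)" if "t \<in> I" for t
    using affine_speed_pos[OF that] by (simp flip: Y[OF that] add: affine_velocity_def)
  define q where "q u = u *\<^sub>R B + (u\<^sup>2 / 2) *\<^sub>R C" for u
  have dq: "((\<lambda>t. X t - q (\<sigma> t)) has_vector_derivative 0) (at t within I)" if t: "t \<in> I" for t
  proof -
    have s2: "((\<lambda>t. (\<sigma> t)\<^sup>2 / 2) has_real_derivative \<sigma> t * affine_speed t) (at t)"
      using DERIV_cdivide[OF DERIV_power[OF d\<sigma>[OF t], of 2], of 2] by (simp add: mult.commute)
    have "((\<lambda>t. q (\<sigma> t)) has_vector_derivative affine_speed t *\<^sub>R B + (\<sigma> t * affine_speed t) *\<^sub>R C) (at t)"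
      unfolding q_def
      using has_vector_derivative_add[OF has_vector_derivative_scaleR[OF d\<sigma>[OF t] has_vector_derivative_const[of B]]
          has_vector_derivative_scaleR[OF s2 has_vector_derivative_const[of C]]] by simp
    from has_vector_derivative_diff[OF X_deriv[OF t] this]
    have "((\<lambda>t. X t - q (\<sigma> t)) has_vector_derivative 0) (at t)"
      by (simp add: VY[OF t] algebra_simps)
    then show "((\<lambda>t. X t - q (\<sigma> t)) has_vector_derivative 0) (at t within I)"
      by (rule has_vector_derivative_at_within)
  qed
  obtain A where A: "\<And>t. t \<in> I \<Longrightarrow> X t - q (\<sigma> t) = A"
    using has_vector_derivative_zero_constant[OF conv dq] by blast
  have X: "X t = A + \<sigma> t *\<^sub>R B + ((\<sigma> t)\<^sup>2 / 2) *\<^sub>R C" if "t \<in> I" for t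
    unfolding A[OF that, symmetric] q_def by simp
  have inj: "inj_on \<sigma> I"
  proof (rule inj_onI)
    fix s t assume "s \<in> I" "t \<in> I" "\<sigma> s = \<sigma> t"
    then have "X s = X t" using X[of s] X[of t] by simp
    then show "s = t" using inj_onD[OF inj_X] \<open>s \<in> I\<close> \<open>t \<in> I\<close> by blast
  qed
  have cont: "continuous_on I \<sigma>"
    by (intro continuous_at_imp_continuous_on ballI DERIV_isCont[OF d\<sigma>])
  have "open (\<sigma> ` I)" using injective_eq_1d_open_map_UNIV[OF cont interval_I] inj open_I by simp
  moreover have "connected (\<sigma> ` I)"
    using connected_continuous_image[OF cont] interval_I is_interval_connected by blast
  moreover have "\<sigma> ` I \<noteq> {}" using nonempty_I by simp
  moreover have "X ` I = (\<lambda>u. A + u *\<^sub>R B + (u\<^sup>2 / 2) *\<^sub>R C) ` \<sigma> ` I"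
    unfolding image_image by (rule image_cong[OF refl X])
  ultimately show thesis using that BC by blast
qed

end

section \<open>Parabolas\<close>

text \<open>The squared focus-directrix equation.\<close>

lemma parabola_eq:
  assumes n: "norm v = 1"
  shows "dist p F = infdist p (line_dir a v) \<longleftrightarrow>
    (v \<bullet> (p - F))\<^sup>2 = 2 * cross2 v (F - a) * cross2 v (p - F) + (cross2 v (F - a))\<^sup>2"
proof -
  have "(dist p F)\<^sup>2 = (p - F) \<bullet> (p - F)" by (simp add: dist_norm power2_norm_eq_inner)
  also have "\<dots> = (v \<bullet> (p - F))\<^sup>2 + (cross2 v (p - F))\<^sup>2"
    using lagrange_cross2[of v "p - F"] n by (simp add: norm_eq_1)
  finally have d: "(dist p F)\<^sup>2 = (v \<bullet> (p - F))\<^sup>2 + (cross2 v (p - F))\<^sup>2" .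
  have i: "(infdist p (line_dir a v))\<^sup>2 = (cross2 v (p - F) + cross2 v (F - a))\<^sup>2"
    unfolding infdist_line_dir[OF n] by (simp add: cross2_add)
  have "dist p F = infdist p (line_dir a v) \<longleftrightarrow> (dist p F)\<^sup>2 = (infdist p (line_dir a v))\<^sup>2"
    by (simp add: infdist_nonneg power2_eq_iff_nonneg)
  then show ?thesis unfolding d i by (auto simp: power2_eq_square algebra_simps)
qed

text \<open>The axis of the parabola has the direction of \<open>C\<close>, its vertex is \<open>O'\<close>, and \<open>f\<close> is the distance from the
  vertex to the focus.\<close>

lemma parabola_quadratic_range:
  assumes BC: "cross2 B C \<noteq> 0"
  shows "parabola (range (\<lambda>u. A + u *\<^sub>R B + (u\<^sup>2 / 2) *\<^sub>R C))"
proof -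
  define c where "c = norm C"
  have c: "c > 0" using BC by (auto simp: c_def)
  define k where "k = (1 / c) *\<^sub>R C"
  define v where "v = - rot k"
  have k1: "k \<bullet> k = 1" using c unfolding norm_eq_1[symmetric] by (simp add: k_def c_def)
  have C: "C = c *\<^sub>R k" using c by (simp add: k_def)
  have v1: "v \<bullet> v = 1" "norm v = 1" using k1 by (simp_all add: v_def rot_def norm_eq_1 plane_simps)
  have vk: "v \<bullet> k = 0" "cross2 v k = 1" and cv: "cross2 v z = k \<bullet> z" for z
    using k1 by (simp_all add: v_def plane_simps algebra_simps)
  define \<beta> b where "\<beta> = v \<bullet> B" and "b = k \<bullet> B"
  have B: "B = \<beta> *\<^sub>R v + b *\<^sub>R k"
    unfolding \<beta>_def b_def v_def plane_simps using k1 unfolding plane_simps by (simp; algebra)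
  have "cross2 B C = \<beta> * c" unfolding B C using vk by (simp add: cross2_add)
  then have \<beta>: "\<beta> \<noteq> 0" using BC by auto
  define f where "f = \<beta>\<^sup>2 / (2 * c)"
  have f: "f \<noteq> 0" using \<beta> c by (simp add: f_def)
  define O' where "O' = A - (b / c * \<beta>) *\<^sub>R v - (b\<^sup>2 / (2 * c)) *\<^sub>R k"
  define F a where "F = O' + f *\<^sub>R k" and "a = O' - f *\<^sub>R k"
  have "F - a = (f + f) *\<^sub>R k" unfolding F_def a_def scaleR_add_left by simp
  then have Fa: "cross2 v (F - a) = 2 * f" using vk by simp
  have on: "dist p F = infdist p (line_dir a v) \<longleftrightarrow> (v \<bullet> (p - O'))\<^sup>2 = 4 * f * (k \<bullet> (p - O'))" for p
  proof -
    have e1: "v \<bullet> (p - F) = v \<bullet> (p - O')" by (simp add: F_def vk inner_diff_right inner_add_right)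
    have e2: "cross2 v (p - F) = k \<bullet> (p - O') - f"
      by (simp add: F_def cv k1 inner_diff_right inner_add_right)
    have e3: "2 * (2 * f) * (y - f) + (2 * f)\<^sup>2 = 4 * f * y" for y
      by (simp add: power2_eq_square algebra_simps)
    show ?thesis unfolding parabola_eq[OF v1(2)] Fa e1 e2 e3 ..
  qed
  have rep: "A + u *\<^sub>R B + (u\<^sup>2 / 2) *\<^sub>R C = O' + (\<beta> * (u + b / c)) *\<^sub>R v + (c / 2 * (u + b / c)\<^sup>2) *\<^sub>R k" for u
  proof -
    have e: "c / 2 * (u + b / c)\<^sup>2 = u * b + u\<^sup>2 / 2 * c + b\<^sup>2 / (2 * c)"
      using c by (simp add: power2_eq_square field_simps)
    show ?thesis unfolding e O'_def B C by (simp add: algebra_simps)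
  qed
  have "range (\<lambda>u. A + u *\<^sub>R B + (u\<^sup>2 / 2) *\<^sub>R C) = {p. dist p F = infdist p (line_dir a v)}"
  proof (intro equalityI subsetI)
    fix p assume "p \<in> range (\<lambda>u. A + u *\<^sub>R B + (u\<^sup>2 / 2) *\<^sub>R C)"
    then obtain u where "p - O' = (\<beta> * (u + b / c)) *\<^sub>R v + (c / 2 * (u + b / c)\<^sup>2) *\<^sub>R k"
      unfolding rep by auto
    then have q: "v \<bullet> (p - O') = \<beta> * (u + b / c)" "k \<bullet> (p - O') = c / 2 * (u + b / c)\<^sup>2"
      using vk v1 k1 by (simp_all add: inner_add_right inner_commute)
    have "(v \<bullet> (p - O'))\<^sup>2 = 4 * f * (k \<bullet> (p - O'))"
      unfolding q f_def using c by (simp add: power_mult_distrib)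
    then show "p \<in> {p. dist p F = infdist p (line_dir a v)}" using on by simp
  next
    fix p assume "p \<in> {p. dist p F = infdist p (line_dir a v)}"
    then have q: "(v \<bullet> (p - O'))\<^sup>2 = 4 * f * (k \<bullet> (p - O'))" using on by simp
    define u where "u = v \<bullet> (p - O') / \<beta> - b / c"
    have u: "\<beta> * (u + b / c) = v \<bullet> (p - O')" using \<beta> by (simp add: u_def)
    then have "\<beta>\<^sup>2 * (u + b / c)\<^sup>2 = 4 * f * (k \<bullet> (p - O'))" using q by (metis power_mult_distrib)
    then have qk: "k \<bullet> (p - O') = c / 2 * (u + b / c)\<^sup>2" using \<beta> c by (simp add: f_def field_simps)
    have dec: "p - O' = (v \<bullet> (p - O')) *\<^sub>R v + (k \<bullet> (p - O')) *\<^sub>R k"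
    proof -
      have "z = (v \<bullet> z) *\<^sub>R v + (k \<bullet> z) *\<^sub>R k" for z
        using k1 unfolding v_def plane_simps by (simp; algebra)
      then show ?thesis .
    qed
    have "A + u *\<^sub>R B + (u\<^sup>2 / 2) *\<^sub>R C = O' + (p - O')"
      by (subst dec) (simp only: rep[unfolded add.assoc] u qk add.assoc)
    then have "p = A + u *\<^sub>R B + (u\<^sup>2 / 2) *\<^sub>R C" by simp
    then show "p \<in> range (\<lambda>u. A + u *\<^sub>R B + (u\<^sup>2 / 2) *\<^sub>R C)" by blast
  qed
  moreover have "v \<noteq> 0" using v1 by auto
  moreover have "F \<notin> line_dir a v"
    using Fa f in_line_dir_iff_cross2[OF \<open>v \<noteq> 0\<close>] by simp
  ultimately show ?thesis unfolding parabola_def by blast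
qed

lemma open_part_of_quadratic_arc:
  assumes BC: "cross2 B C \<noteq> 0" and J: "open J" "connected J" "J \<noteq> {}"
  shows "open_part_of_parabola ((\<lambda>u. A + u *\<^sub>R B + (u\<^sup>2 / 2) *\<^sub>R C) ` J)"
proof -
  define g where "g u = A + u *\<^sub>R B + (u\<^sup>2 / 2) *\<^sub>R C" for u
  define h where "h p = cross2 (p - A) C / cross2 B C" for p
  have hg: "h (g u) = u" for u using BC by (simp add: h_def g_def cross2_add)
  have ch: "continuous_on UNIV h"
    unfolding h_def using BC by (intro continuous_intros) auto
  have "g ` J = range g \<inter> h -` J"
    using hg by (force simp: image_iff)
  moreover have "open (h -` J)" using continuous_open_vimage[of J h] ch J(1) by (simp add: continuous_on_eq_continuous_at)
  ultimately have "openin (top_of_set (range g)) (g ` J)" by (simp add: openin_open_Int)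
  moreover have "connected (g ` J)"
    unfolding g_def by (intro connected_continuous_image continuous_intros J) auto
  moreover have "parabola (range g)" unfolding g_def[abs_def] by (rule parabola_quadratic_range[OF BC])
  ultimately show ?thesis unfolding open_part_of_parabola_def g_def[abs_def] using J(3) by blast
qed

text \<open>Expanding the equation of a parabola at one of its points \<open>P\<close> leaves the square of a linear form
  plus an independent linear form.\<close>

lemma parabola_local_equation:
  assumes S: "parabola S" and P: "P \<in> S"
  obtains u j where "cross2 u j \<noteq> 0" "\<And>p. p \<in> S \<Longrightarrow> (u \<bullet> (p - P))\<^sup>2 + j \<bullet> (p - P) = 0"
proof -
  obtain F a v0 where v0: "v0 \<noteq> 0" "F \<notin> line_dir a v0" and S0: "S = {p. dist p F = infdist p (line_dir a v0)}"
    using S by (auto simp: parabola_def)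
  define v where "v = (1 / norm v0) *\<^sub>R v0"
  have v: "norm v = 1" "v \<noteq> 0" using v0 by (auto simp: v_def)
  have l: "line_dir a v = line_dir a v0" unfolding v_def using v0 by (intro line_dir_scale) simp
  define m where "m = cross2 v (F - a)"
  have m: "m \<noteq> 0" using v0(2) unfolding l[symmetric] in_line_dir_iff_cross2[OF v(2)] m_def .
  have on: "(v \<bullet> (p - F))\<^sup>2 = 2 * m * cross2 v (p - F) + m\<^sup>2" if "p \<in> S" for p
    using that parabola_eq[OF v(1)] unfolding S0 l[symmetric] m_def by blast
  define j where "j = (2 * (v \<bullet> (P - F))) *\<^sub>R v - (2 * m) *\<^sub>R rot v"
  have "cross2 v j = - (2 * m)" using v by (simp add: j_def cross2_add cross2_rot norm_eq_1)
  then have "cross2 v j \<noteq> 0" using m by simp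
  moreover have "(v \<bullet> (p - P))\<^sup>2 + j \<bullet> (p - P) = 0" if "p \<in> S" for p
  proof -
    have e: "p - F = (p - P) + (P - F)" by simp
    have "j \<bullet> (p - P) = 2 * (v \<bullet> (P - F)) * (v \<bullet> (p - P)) - 2 * m * cross2 v (p - P)"
      by (simp add: j_def inner_diff_left rot_inner)
    moreover have "(v \<bullet> (p - P) + v \<bullet> (P - F))\<^sup>2 = 2 * m * (cross2 v (p - P) + cross2 v (P - F)) + m\<^sup>2"
      using on[OF that] unfolding e inner_add_right cross2_add(1) .
    ultimately show ?thesis using on[OF P] by (simp add: power2_eq_square algebra_simps)
  qed
  ultimately show thesis by (rule that)
qed

context convex_arc
begin

text \<open>With \<open>p\<close>, \<open>k\<close> the values of the linear form \<open>u\<close> on the frame vectors, the curve satisfies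
  \<open>(\<xi> * p + H * k)\<^sup>2 = \<beta> * H\<close>. At height \<open>c\<close> the two endpoints give opposite values \<open>r1 = - r2\<close> of
  \<open>\<xi> * p + c * k\<close>, so the width is \<open>2 * r2 / p\<close> and \<open>c\<close> times the slope gap is \<open>r2 / p\<close>.\<close>

lemma ratio_on_parabola:
  assumes S: "parabola S" and sub: "X ` I \<subseteq> S" and t: "t \<in> I"
  shows "\<forall>\<^sub>F c in at_right 0. ratio t c = 1/2"
proof -
  obtain u j where uj: "cross2 u j \<noteq> 0" and q: "\<And>s. s \<in> I \<Longrightarrow> (u \<bullet> (X s - X t))\<^sup>2 + j \<bullet> (X s - X t) = 0"
    using parabola_local_equation[OF S, of "X t"] sub t by (metis image_subset_iff)
  have q': "2 * (u \<bullet> (X s - X t)) * (u \<bullet> V s) + j \<bullet> V s = 0" if s: "s \<in> I" for s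
  proof -
    have "((\<lambda>s. (u \<bullet> (X s - X t))\<^sup>2 + j \<bullet> (X s - X t)) has_real_derivative
        2 * (u \<bullet> (X s - X t)) * (u \<bullet> V s) + j \<bullet> V s) (at s)"
      using DERIV_add[OF DERIV_power[OF cross2_inner_has_real_derivative(2)[OF X_diff_deriv[OF s], of u t], of 2]
          cross2_inner_has_real_derivative(2)[OF X_diff_deriv[OF s], of j t]]
      by (simp add: mult_ac)
    moreover have "((\<lambda>s. (u \<bullet> (X s - X t))\<^sup>2 + j \<bullet> (X s - X t)) has_real_derivative 0) (at s)"
      by (rule has_field_derivative_transform_within_open[OF DERIV_const open_I s]) (use q in auto)
    ultimately show ?thesis by (rule DERIV_unique)
  qed
  have jV: "j \<bullet> V t = 0" using q'[OF t] by simp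
  define p k \<beta> where "p = u \<bullet> V t" and "k = u \<bullet> conormal t" and "\<beta> = - (j \<bullet> conormal t)"
  have p: "p \<noteq> 0"
  proof
    assume "p = 0"
    then have "cross2 u j *\<^sub>R V t = 0" using jV unfolding p_def plane_simps by (simp; algebra)
    then show False using uj V_nz[OF t] by simp
  qed
  have curve: "(\<xi> t s * p + H t s * k)\<^sup>2 = \<beta> * H t s" if s: "s \<in> I" for s
    using q[OF s] unfolding frame_X[OF t, of s] 
    by (simp add: inner_add_right jV p_def k_def \<beta>_def eq_neg_iff_add_eq_0 mult.commute)
  have tangent: "2 * (\<xi> t s * p + H t s * k) * (\<xi>' t s * p + H' t s * k) = \<beta> * H' t s" if s: "s \<in> I" for s
    using q'[OF s] unfolding frame_X[OF t, of s] frame_V[OF t, of s]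
    by (simp add: inner_add_right jV p_def k_def \<beta>_def eq_neg_iff_add_eq_0 mult.commute)
  obtain \<delta> where gr: "graph_radius t \<delta>" using ex_graph_radius[OF t] .
  show ?thesis using eventually_chord[OF t gr]
  proof eventually_elim
    case (elim c)
    define s1 s2 where "s1 = lo t c" and "s2 = hi t c"
    have c: "c > 0" and ch: "chord t c s1 s2" and n: "t - \<delta> < s1" "s2 < t + \<delta>"
      using elim by (auto simp: s1_def s2_def)
    note chD = chordD[OF ch]
    have "H' t s1 < 0" "0 < H' t s2" using gr chD n by (auto simp: graph_radius_def)
    then have h: "H' t s1 \<noteq> 0" "H' t s2 \<noteq> 0" by auto
    have wd: "width t s1 s2 > 0" by (rule chord_areas(1)[OF t gr ch n c])
    define r1 r2 where "r1 = \<xi> t s1 * p + c * k" and "r2 = \<xi> t s2 * p + c * k"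
    have r: "r1\<^sup>2 = \<beta> * c" "r2\<^sup>2 = \<beta> * c" using curve[OF chD(3)] curve[OF chD(4)] chD by (simp_all add: r1_def r2_def)
    have rw: "r2 - r1 = width t s1 s2 * p" by (simp add: r1_def r2_def width_def algebra_simps)
    then have "r1 \<noteq> r2" using wd p by auto
    then have r12: "r1 = - r2" using r by (metis power2_eq_iff)
    then have r2: "r2 \<noteq> 0" using \<open>r1 \<noteq> r2\<close> by auto
    have slope: "\<xi>' t s / H' t s = (\<beta> / (2 * r) - k) / p"
      if "2 * r * (\<xi>' t s * p + H' t s * k) = \<beta> * H' t s" "H' t s \<noteq> 0" "r \<noteq> 0" for s r
    proof -
      have "\<xi>' t s * p + H' t s * k = \<beta> * H' t s / (2 * r)" using that(1,3) by (simp add: field_simps)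
      then show ?thesis using that(2) p by (simp add: field_simps)
    qed
    have "slope_gap t s1 s2 = (\<beta> / (2 * r2) - k) / p - (\<beta> / (2 * r1) - k) / p"
      unfolding slope_gap_def
      using slope[of r1 s1] slope[of r2 s2] tangent[OF chD(3)] tangent[OF chD(4)] h r2 r12 chD(5,6)
      by (simp add: r1_def r2_def)
    also have "\<dots> = \<beta> / (r2 * p)" using r2 p unfolding r12 by (simp add: field_simps)
    finally have "c * slope_gap t s1 s2 = r2\<^sup>2 / (r2 * p)" using r by simp
    also have "\<dots> = r2 / p" using r2 by (simp add: power2_eq_square)
    also have "\<dots> = width t s1 s2 / 2"
    proof -
      have "2 * r2 = width t s1 s2 * p" using rw r12 by simp
      then show ?thesis using p by (simp add: field_simps)
    qed
    finally show ?case using wd unfolding ratio_def s1_def s2_def by simp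
  qed
qed

lemma half_ratio_iff_open_part_of_parabola:
  "(\<forall>t\<in>I. \<forall>\<^sub>F c in at_right 0. ratio t c = 1/2) \<longleftrightarrow> open_part_of_parabola (X ` I)"
proof
  assume "\<forall>t\<in>I. \<forall>\<^sub>F c in at_right 0. ratio t c = 1/2"
  then have "parabolic_chords" unfolding parabolic_chords_def using width_of_half_ratio by blast
  then obtain A B C J where J: "cross2 B C \<noteq> 0" "open J" "connected J" "J \<noteq> {}"
    and XI: "X ` I = (\<lambda>u. A + u *\<^sub>R B + (u\<^sup>2 / 2) *\<^sub>R C) ` J"
    by (rule quadratic_parametrization)
  show "open_part_of_parabola (X ` I)" unfolding XI by (rule open_part_of_quadratic_arc[OF J])
next
  assume "open_part_of_parabola (X ` I)"
  then obtain S where "parabola S" "X ` I \<subseteq> S"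
    by (auto simp: open_part_of_parabola_def dest: openin_imp_subset)
  then show "\<forall>t\<in>I. \<forall>\<^sub>F c in at_right 0. ratio t c = 1/2" using ratio_on_parabola by blast
qed

end

theorem theorem1p3:
  fixes X :: "real \<Rightarrow> real^2" and I :: "real set"
  assumes "strictly_convex_curve X I"
  shows "((\<exists>lam :: real^2 \<Rightarrow> real. \<forall>t\<in>I. \<exists>h0>0. \<forall>h. 0 < h \<and> h < h0 \<longrightarrow>
             U_area X I t h = lam (X t) * T_area X I t h)
          \<longleftrightarrow>
          (\<forall>t\<in>I. \<exists>h0>0. \<forall>h. 0 < h \<and> h < h0 \<longrightarrow>
             U_area X I t h = 1 / 2 * T_area X I t h))
       \<and> ((\<forall>t\<in>I. \<exists>h0>0. \<forall>h. 0 < h \<and> h < h0 \<longrightarrow>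
             U_area X I t h = 1 / 2 * T_area X I t h)
          \<longleftrightarrow>
          open_part_of_parabola (X ` I))"
proof -
  obtain \<epsilon> where arc: "convex_arc X (velocity X) (velocity (velocity X))
      (velocity (velocity (velocity X))) I \<epsilon>"
    using strictly_convex_curve_imp_convex_arc[OF assms] .
  interpret convex_arc X "velocity X" "velocity (velocity X)" "velocity (velocity (velocity X))" I \<epsilon>
    by (rule arc)
  have ev: "(\<exists>h0>0. \<forall>h. 0 < h \<and> h < h0 \<longrightarrow> P h) \<longleftrightarrow> (\<forall>\<^sub>F h in at_right 0. P h)" for P :: "real \<Rightarrow> bool"
    by (auto simp: eventually_at_right_field)
  have "(\<exists>lam :: real^2 \<Rightarrow> real. \<forall>t\<in>I. \<forall>\<^sub>F h in at_right 0. U_area X I t h = lam (X t) * T_area X I t h)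
     \<longleftrightarrow> (\<forall>t\<in>I. \<forall>\<^sub>F h in at_right 0. U_area X I t h = 1 / 2 * T_area X I t h)"
  proof
    assume "\<exists>lam :: real^2 \<Rightarrow> real. \<forall>t\<in>I. \<forall>\<^sub>F h in at_right 0. U_area X I t h = lam (X t) * T_area X I t h"
    then obtain lam :: "real^2 \<Rightarrow> real"
      where lam: "\<And>t. t \<in> I \<Longrightarrow> \<forall>\<^sub>F h in at_right 0. U_area X I t h = lam (X t) * T_area X I t h" by blast
    show "\<forall>t\<in>I. \<forall>\<^sub>F h in at_right 0. U_area X I t h = 1 / 2 * T_area X I t h"
    proof
      fix t assume t: "t \<in> I"
      show "\<forall>\<^sub>F h in at_right 0. U_area X I t h = 1 / 2 * T_area X I t h"
        using lam[OF t] unfolding area_ratio_is_half[OF t lam[OF t]] .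
    qed
  qed (rule exI[of _ "\<lambda>_. 1 / 2"])
  moreover have "(\<forall>t\<in>I. \<forall>\<^sub>F h in at_right 0. U_area X I t h = 1 / 2 * T_area X I t h)
      \<longleftrightarrow> open_part_of_parabola (X ` I)"
    unfolding half_ratio_iff_open_part_of_parabola[symmetric] using half_area_iff_ratio by blast
  ultimately show ?thesis unfolding ev by blast
qed

end
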